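(* Let $\alpha\in(0,1)$, $\lambda\in\mathbb{C}$, $\lambda\neq0$, $\arg(\lambda)\in(-\pi\alpha,\pi\alpha)$. For $k=1,2,\dots$ put $$a_{k}=-\frac{e^{i\pi\alpha}\sin(\pi\alpha)}{\pi\lambda^{k}}\left(\frac{\sin((k+1)\pi\alpha)}{\sin(\pi\alpha)}-e^{ik\pi\alpha}\right),\qquad b_{k}=-\frac{1}{\lambda}a_{k}.$$ Then, as $t\to\infty$, $$E_{\alpha}(\lambda t^{\alpha})-\frac{1}{\alpha}e^{\lambda^{1/\alpha}t}\sim\sum_{k=1}^{\infty}\frac{a_{k}\Gamma(k\alpha)}{t^{k\alpha}},$$ $$t^{\alpha-1}E_{\alpha,\alpha}(\lambda t^{\alpha})-\frac{\lambda^{\frac{1-\alpha}{\alpha}}}{\alpha}e^{\lambda^{1/\alpha}t}\sim\sum_{k=1}^{\infty}\frac{b_{k}\Gamma(k\alpha+1)}{t^{k\alpha+1}}.$$ Moreover, there exist $t_{0}>0$ and constants $K_{\alpha,\lambda}$, $L_{\alpha,\lambda}$ depending on $\alpha,\lambda$ such that $$\left|E_{\alpha}(\lambda t^{\alpha})-\frac{1}{\alpha}e^{\lambda^{1/\alpha}t}\right|\leq\frac{K_{\alpha,\lambda}}{t^{\alpha}}\quad\text{for all }t\in(0,\infty),$$ $$\left|t^{\alpha-1}E_{\alpha,\alpha}(\lambda t^{\alpha})-\frac{\lambda^{\frac{1-\alpha}{\alpha}}}{\alpha}e^{\lambda^{1/\alpha}t}\right|\leq\frac{L_{\alpha,\lambda}}{t^{\alpha+1}}\quad\text{for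 all }t\in[t_{0},\infty).$$
   Context: The Mittag-Leffler function is $E_{\alpha,\beta}(z)=\sum_{k=0}^{\infty}\frac{z^{k}}{\Gamma(k\alpha+\beta)}$ for $\alpha>0$, $\beta>0$, $z\in\mathbb{C}$, and $E_{\alpha}(z)=E_{\alpha,1}(z)$. Complex powers of $\lambda$ are principal: $\lambda^{s}=\exp(s\,\mathrm{Log}\,\lambda)$ with $\arg\lambda\in(-\pi,\pi]$. The notation $g(t)\sim\sum_{k=1}^{\infty}c_{k}t^{-\mu_{k}}$ as $t\to\infty$ (with $0<\mu_1<\mu_2<\cdots$) denotes a Poincaré asymptotic expansion: for every $N\ge1$, $g(t)-\sum_{k=1}^{N}c_{k}t^{-\mu_{k}}=o(t^{-\mu_{N}})$ as $t\to\infty$. *)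

theory Defs
  imports "HOL-Analysis.Analysis" "HOL-Library.Landau_Symbols"
begin

definition mittag_leffler :: "real \<Rightarrow> real \<Rightarrow> complex \<Rightarrow> complex" where
  "mittag_leffler \<alpha> \<beta> z = (\<Sum>k. z ^ k / of_real (Gamma (real k * \<alpha> + \<beta>)))"

text \<open>
  Poincare asymptotic expansion of \<open>g t\<close> as \<open>t\<close> tends to infinity, with terms \<open>c k * t powr (- \<mu> k)\<close>.
  Terms are indexed from 1; the values of \<open>c\<close> and \<open>\<mu>\<close> at 0 play no role.
\<close>

definition has_poincare_expansion ::
    "(real \<Rightarrow> complex) \<Rightarrow> (nat \<Rightarrow> complex) \<Rightarrow> (nat \<Rightarrow> real) \<Rightarrow> bool" where
  "has_poincare_expansion g c \<mu> \<longleftrightarrow>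
     0 < \<mu> 1 \<and> strict_mono_on {1..} \<mu> \<and>
     (\<forall>N\<ge>1. (\<lambda>t. g t - (\<Sum>k=1..N. c k * of_real (t powr (- \<mu> k))))
               \<in> o[at_top](\<lambda>t. of_real (t powr (- \<mu> N))))"

definition coeff_a :: "real \<Rightarrow> complex \<Rightarrow> nat \<Rightarrow> complex" where
  "coeff_a \<alpha> lam k =
     - (exp (\<i> * of_real (pi * \<alpha>)) * of_real (sin (pi * \<alpha>)) / (of_real pi * lam ^ k)) *
       (of_real (sin (real (k + 1) * pi * \<alpha>) / sin (pi * \<alpha>)) - exp (\<i> * of_real (real k * pi * \<alpha>)))"

definition coeff_b :: "real \<Rightarrow> complex \<Rightarrow> nat \<Rightarrow> complex" where
  "coeff_b \<alpha> lam k = - (1 / lam) * coeff_a \<alpha> lam k"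

end

(*
  Write the Hankel contour integral of a function of s = exp w in the logarithmic coordinate w,
  where there is no branch cut: the contour becomes the vertical segment Re w = b, |Im w| <= pi
  together with the two rays Re w >= b, Im w = -pi and Im w = pi. Hankel's formula
  1 / Gamma(beta) = 1/(2 pi i) * integral of exp (exp w + (1 - beta) w), summed as a geometric series,
  represents E_{alpha,beta}(z) as the integral of
  exp (exp w + (1 + alpha - beta) w) / (exp (alpha w) - z) as soon as exp (alpha b) > |z|.
  Moving the segment to Re w = -infinity crosses the single pole w = Ln z / alpha of the strip
  |Im w| < pi, whose residue is the exponential term. What is left is the integral over the two full
  lines Im w = -pi and Im w = pi; there 1 / (u - z), with u = exp (alpha w), is expanded in powers of
  u / z, and the term-by-term integrals of exp (c x - exp x) are Gamma values.
*)
theory Submission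
  imports Defs "HOL-Complex_Analysis.Complex_Analysis" "HOL-Real_Asymp.Real_Asymp"
begin

subsection \<open>Hankel contours in the logarithmic coordinate\<close>

text \<open>Euler's integral under the substitution \<open>r = exp x\<close>: the measure
  \<open>r powr (c - 1) / exp r\<close> dr becomes \<open>exp (c * x - exp x)\<close> dx. The lines
  Im w = -pi and Im w = pi produce integrals of this shape, because exp w = - exp (Re w)
  there.\<close>

lemma has_bochner_integral_exp_minus_exp:
  fixes c :: real
  assumes "c > 0"
  shows "has_bochner_integral lborel (\<lambda>x. exp (c * x - exp x)) (Gamma c)"
proof -
  have eq: "exp (c * ln r - exp (ln r)) * (1 / r) = r powr (c - 1) / exp r" if "0 < r" for r
    using that by (simp add: powr_def exp_diff algebra_simps)
  \<comment> \<open>The integrand is nonnegative, so the gauge integral of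
    \<open>Gamma_integral_real\<close> is also a Lebesgue integral.\<close>
  have "(\<lambda>t. t powr (c - 1) / exp t) absolutely_integrable_on {0..}"
    using Gamma_integral_real[OF assms]
    by (intro nonnegative_absolutely_integrable_1) (auto simp: has_integral_iff)
  then have "set_integrable lborel {0..} (\<lambda>t. t powr (c - 1) / exp t)"
    unfolding absolutely_integrable_on_def set_integrable_def
    by (subst (asm) integrable_completion) auto
  then have int: "set_integrable lborel {0<..} (\<lambda>t. t powr (c - 1) / exp t)"
    by (rule set_integrable_subset) auto
  have val: "(LINT t:{0<..}|lborel. t powr (c - 1) / exp t) = Gamma c"
  proof -
    have "((\<lambda>t. t powr (c - 1) / exp t) has_integral Gamma c) {0<..}"
    proof -
      have "((\<lambda>t. if t \<in> {0<..} then t powr (c - 1) / exp t else 0) has_integral Gamma c) {0..}"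
        by (rule has_integral_spike[OF _ _ Gamma_integral_real[OF assms], of "{0}"]) auto
      then show ?thesis
        by (subst (asm) has_integral_restrict) auto
    qed
    then show ?thesis
      using set_borel_integral_eq_integral(2)[OF int] by (simp add: integral_unique)
  qed
  have ein: "einterval 0 \<infinity> = {0<..}" "einterval (-\<infinity>) \<infinity> = UNIV"
    by (auto simp: einterval_def)
  have int': "set_integrable lborel (einterval 0 \<infinity>) (\<lambda>r. exp (c * ln r - exp (ln r)) * (1 / r))"
    unfolding ein using int by (subst set_integrable_cong[OF refl refl eq]) auto
  have A: "((ereal \<circ> ln \<circ> real_of_ereal) \<longlongrightarrow> -\<infinity>) (at_right 0)"
    unfolding zero_ereal_def ereal_tendsto_simps by (rule ln_at_0)
  have B: "((ereal \<circ> ln \<circ> real_of_ereal) \<longlongrightarrow> \<infinity>) (at_left \<infinity>)"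
    unfolding ereal_tendsto_simps by (rule ln_at_top)
  have DERIV: "DERIV ln x :> 1 / x" if "0 < ereal x" for x
    using that by (auto intro!: derivative_eq_intros)
  have cont: "isCont (\<lambda>x. exp (c * x - exp x)) x" for x
    by (intro continuous_intros)
  have cont': "isCont (\<lambda>r. 1 / r) x" if "0 < ereal x" for x
    using that by (intro continuous_intros) auto
  have nonneg: "0 \<le> 1 / x" if "0 \<le> ereal x" for x
    using that by simp
  note S = interval_integral_substitution_nonneg[of 0 \<infinity> ln "\<lambda>r. 1 / r" "\<lambda>x. exp (c * x - exp x)",
      OF _ DERIV cont cont' _ nonneg A B int', simplified ein]
  have d1: "set_integrable lborel UNIV (\<lambda>x. exp (c * x - exp x))"
    and d2: "(LBINT x=-\<infinity>..\<infinity>. exp (c * x - exp x)) = (LBINT r=0..\<infinity>. exp (c * ln r - exp (ln r)) * (1 / r))"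
    using S by auto
  have "(LBINT r=0..\<infinity>. exp (c * ln r - exp (ln r)) * (1 / r)) = Gamma c"
    unfolding val[symmetric] using eq by (subst interval_lebesgue_integral_le_eq) (auto simp: ein intro!: set_lebesgue_integral_cong)
  then show ?thesis
    using d1 d2 by (simp add: has_bochner_integral_iff set_integrable_def
        interval_lebesgue_integral_le_eq ein set_lebesgue_integral_def)
qed

text \<open>Away from -infinity every real exponent is admissible: compared with
  \<open>c' = max c 1\<close> there is only the extra factor \<open>exp ((c - c') * x)\<close>,
  which is bounded for \<open>x \<ge> a\<close> because \<open>c - c' \<le> 0\<close>.\<close>

lemma set_integrable_exp_minus_exp:
  fixes a c :: real
  shows "set_integrable lborel {a..} (\<lambda>x. exp (c * x - exp x))"
proof -
  define c' where "c' = max c 1"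
  have "integrable lborel (\<lambda>x. exp ((c - c') * a) * exp (c' * x - exp x))"
    using has_bochner_integral_exp_minus_exp[of c'] by (auto simp: c'_def has_bochner_integral_iff)
  then show ?thesis
    unfolding set_integrable_def
  proof (rule Bochner_Integration.integrable_bound)
    have "exp (c * x - exp x) \<le> exp ((c - c') * a) * exp (c' * x - exp x)" if "x \<ge> a" for x
    proof -
      have "(c - c') * x \<le> (c - c') * a"
        using that by (intro mult_left_mono_neg) (auto simp: c'_def)
      then show ?thesis
        unfolding exp_add[symmetric] by (simp add: algebra_simps)
    qed
    then show "AE x in lborel. norm (indicator {a..} x *\<^sub>R exp (c * x - exp x))
        \<le> norm (exp ((c - c') * a) * exp (c' * x - exp x))"
      by (auto simp: indicator_def)
  qed measurable
qed

text \<open>In the variable s = exp w the two points are the upper and the lower edge of the cut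
  along the negative real axis, so this is the jump of the integrand across the cut.\<close>

definition branch_jump :: "(complex \<Rightarrow> complex) \<Rightarrow> real \<Rightarrow> complex" where
  "branch_jump f x = f (Complex x pi) - f (Complex x (- pi))"

text \<open>
  The contour is traversed from \<open>+\<infinity> - \<i>\<pi>\<close> to \<open>+\<infinity> + \<i>\<pi>\<close>; the rays do not contribute
  separately but only through \<^const>\<open>branch_jump\<close>, so that periodic integrands are admissible even if
  they do not decay.
\<close>

definition hankel :: "real \<Rightarrow> (complex \<Rightarrow> complex) \<Rightarrow> complex" where
  "hankel b f = \<i> * integral {-pi..pi} (\<lambda>y. f (Complex b y)) + (LINT x:{b..}|lborel. branch_jump f x)"

section \<open>Rectangles, and the shift of the segment to Re w = -infinity\<close>

lemma contour_integral_linepath_same_Im: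
  assumes "a < b"
  shows "contour_integral (linepath (Complex a y) (Complex b y)) f = integral {a..b} (\<lambda>x. f (Complex x y))"
proof -
  have "contour_integral (linepath (Complex a y) (Complex b y)) f =
      contour_integral (linepath (of_real a) (of_real b)) (\<lambda>w. f (w + \<i> * of_real y))"
    unfolding contour_integral_integral linepath_def
    by (intro integral_cong) (auto simp: Complex_eq algebra_simps scaleR_conv_of_real)
  also have "\<dots> = integral {a..b} (\<lambda>x. f (Complex x y))"
    using assms by (subst contour_integral_linepath_Reals_eq) (auto simp: Complex_eq)
  finally show ?thesis .
qed

lemma contour_integral_rectpath:
  assumes "continuous_on (path_image (rectpath (Complex a c) (Complex b d))) f" "a < b" "c < d"
  shows "contour_integral (rectpath (Complex a c) (Complex b d)) f =
    integral {a..b} (\<lambda>x. f (Complex x c)) + \<i> * integral {c..d} (\<lambda>y. f (Complex b y))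
    - integral {a..b} (\<lambda>x. f (Complex x d)) - \<i> * integral {c..d} (\<lambda>y. f (Complex a y))"
proof -
  have pi: "path_image (rectpath (Complex a c) (Complex b d)) =
     closed_segment (Complex a c) (Complex b c) \<union> closed_segment (Complex b c) (Complex b d) \<union>
     closed_segment (Complex b d) (Complex a d) \<union> closed_segment (Complex a d) (Complex a c)"
    by (simp add: rectpath_def Let_def path_image_join Un_assoc)
  have ci: "f contour_integrable_on linepath (Complex a c) (Complex b c)"
     "f contour_integrable_on linepath (Complex b c) (Complex b d)"
     "f contour_integrable_on linepath (Complex b d) (Complex a d)"
     "f contour_integrable_on linepath (Complex a d) (Complex a c)"
    by (rule contour_integrable_continuous_linepath, rule continuous_on_subset[OF assms(1)],
        unfold pi, blast)+
  have rev: "contour_integral (linepath (Complex b d) (Complex a d)) f = - contour_integral (linepath (Complex a d) (Complex b d)) f"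
     "contour_integral (linepath (Complex a d) (Complex a c)) f = - contour_integral (linepath (Complex a c) (Complex a d)) f"
    using contour_integral_reversepath[of "linepath (Complex a d) (Complex b d)" f]
          contour_integral_reversepath[of "linepath (Complex a c) (Complex a d)" f] by simp_all
  show ?thesis
    using ci assms by (simp add: rectpath_def Let_def rev
        contour_integral_linepath_same_Im contour_integral_linepath_same_Re)
qed

lemma tendsto_LINT_atLeast_at_bot:
  fixes d :: "real \<Rightarrow> complex"
  assumes "integrable lborel d"
  shows "((\<lambda>a. LINT x:{a..}|lborel. d x) \<longlongrightarrow> (LINT x|lborel. d x)) at_bot"
  unfolding filterlim_at_bot_mirror set_lebesgue_integral_def
proof (rule integral_dominated_convergence_at_top[where w="\<lambda>x. norm (d x)"])
  show "AE x in lborel. ((\<lambda>t. indicat_real {- t..} x *\<^sub>R d x) \<longlongrightarrow> d x) at_top"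
  proof (rule AE_I2)
    fix x :: real
    have "\<forall>\<^sub>F t in at_top. indicat_real {- t..} x *\<^sub>R d x = d x"
      using eventually_ge_at_top[of "-x"] by eventually_elim (auto simp: indicator_def)
    then show "((\<lambda>t. indicat_real {- t..} x *\<^sub>R d x) \<longlongrightarrow> d x) at_top"
      by (rule tendsto_eventually)
  qed
  show "\<forall>\<^sub>F t in at_top. AE x in lborel. norm (indicat_real {- t..} x *\<^sub>R d x) \<le> norm (d x)"
    by (intro always_eventually allI AE_I2) (auto simp: indicator_def)
qed (use assms in auto)

text \<open>Residue theorem on the rectangle between Re w = a and Re w = b, followed by a ->
  -infinity. The left side disappears by the decay \<open>exp (\<delta> * Re w)\<close>, and the
  horizontal sides extend the rays to full lines. The margin \<open>kap > pi\<close> gives an open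
  strip around the closed one. An entire \<open>f\<close> is covered by taking for \<open>w0\<close>
  a point of residue 0.\<close>

lemma hankel_eq_residue_plus_LINT:
  fixes f :: "complex \<Rightarrow> complex"
  assumes kap: "pi < kap" and holo: "f holomorphic_on {w. \<bar>Im w\<bar> < kap} - {w0}"
    and w0: "\<bar>Im w0\<bar> < pi" "Re w0 < b" and "\<delta> > 0"
    and bound: "\<And>w. Re w \<le> B \<Longrightarrow> \<bar>Im w\<bar> \<le> pi \<Longrightarrow> norm (f w) \<le> C * exp (\<delta> * Re w)"
    and int: "integrable lborel (branch_jump f)"
  shows "hankel b f = 2 * pi * \<i> * residue f w0 + (LINT x|lborel. branch_jump f x)"
proof -
  define S where "S = {w. \<bar>Im w\<bar> < kap}"
  have S_eq: "S = {w. Im w < kap} \<inter> {w. Im w > - kap}"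
    by (auto simp: S_def)
  have S: "open S" "connected S"
    unfolding S_eq by (auto intro!: open_Int open_halfspace_Im_lt open_halfspace_Im_gt
        convex_connected convex_Int convex_halfspace_Im_lt convex_halfspace_Im_gt)
  have cont: "continuous_on (S - {w0}) f"
    using holo unfolding S_def by (rule holomorphic_on_imp_continuous_on)
  define V where "V a = integral {-pi..pi} (\<lambda>y. f (Complex a y))" for a
  have shift: "hankel b f = 2 * pi * \<i> * residue f w0 + \<i> * V a + (LINT x:{a..}|lborel. branch_jump f x)"
    if a: "a < Re w0" for a
  proof -
    have ab: "a < b" using a w0 by simp
    let ?g = "rectpath (Complex a (-pi)) (Complex b pi)"
    have img: "path_image ?g \<subseteq> S - {w0}"
      using ab a w0 kap by (auto simp: path_image_rectpath_cbox_minus_box in_cbox_complex_iff in_box_complex_iff S_def)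
    have "contour_integral ?g f = 2 * pi * \<i> * (\<Sum>p\<in>{w0}. winding_number ?g p * residue f p)"
    proof (rule Residue_theorem[OF S])
      show "\<forall>z. z \<notin> S \<longrightarrow> winding_number ?g z = 0"
        using ab kap by (auto intro!: winding_number_rectpath_outside simp: in_cbox_complex_iff S_def)
    qed (use holo img in \<open>auto simp: S_def\<close>)
    moreover have "winding_number ?g w0 = 1"
      using w0 a by (intro winding_number_rectpath) (auto simp: in_box_complex_iff)
    ultimately have res: "contour_integral ?g f = 2 * pi * \<i> * residue f w0"
      by simp
    have cint: "(\<lambda>x. f (Complex x y)) integrable_on {a..b}" if "y \<in> {pi, -pi}" for y
      by (rule integrable_continuous_real, rule continuous_on_compose2[OF cont])
         (use that w0 kap in \<open>auto simp: S_def Complex_eq intro!: continuous_intros\<close>)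
    have sub: "set_integrable lborel A (branch_jump f)" if "A \<in> sets lborel" for A
    proof (rule set_integrable_subset)
      show "set_integrable lborel UNIV (branch_jump f)"
        using int by (simp add: set_integrable_def)
    qed (use that in auto)
    \<comment> \<open>The horizontal sides are traversed in opposite directions, so they enter only
      through the jump, like the rays. The intervals \<open>{a..b}\<close> and \<open>{b..}\<close>
      overlap in a null set.\<close>
    have "integral {a..b} (\<lambda>x. f (Complex x pi)) - integral {a..b} (\<lambda>x. f (Complex x (-pi)))
        = integral {a..b} (branch_jump f)"
      unfolding branch_jump_def by (rule Henstock_Kurzweil_Integration.integral_diff[symmetric]) (auto intro!: cint)
    also have "\<dots> = (LINT x:{a..b}|lborel. branch_jump f x)"
      by (rule set_borel_integral_eq_integral(2)[symmetric], rule sub) auto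
    also have "\<dots> = (LINT x:{a..}|lborel. branch_jump f x) - (LINT x:{b..}|lborel. branch_jump f x)"
    proof -
      have "AE x in lborel. x \<noteq> b"
        by (rule AE_lborel_singleton)
      then have "AE x in lborel. \<not> (x \<in> {a..b} \<and> x \<in> {b..})"
        by eventually_elim auto
      then have "(LINT x:{a..b} \<union> {b..}|lborel. branch_jump f x) =
          (LINT x:{a..b}|lborel. branch_jump f x) + (LINT x:{b..}|lborel. branch_jump f x)"
        by (rule set_integral_Un_AE) (simp_all add: sub)
      also have "{a..b} \<union> {b..} = {a..}" using ab by auto
      finally show ?thesis by simp
    qed
    finally have jump: "integral {a..b} (\<lambda>x. f (Complex x pi)) - integral {a..b} (\<lambda>x. f (Complex x (-pi))) =
      (LINT x:{a..}|lborel. branch_jump f x) - (LINT x:{b..}|lborel. branch_jump f x)" .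
    have "integral {a..b} (\<lambda>x. f (Complex x (-pi))) + \<i> * V b
        - integral {a..b} (\<lambda>x. f (Complex x pi)) - \<i> * V a = 2 * pi * \<i> * residue f w0"
      using contour_integral_rectpath[OF continuous_on_subset[OF cont img] ab] res
      unfolding V_def by simp
    then show ?thesis
      using jump unfolding hankel_def V_def[of b, symmetric] by (auto simp: algebra_simps) algebra
  qed
  have "(V \<longlongrightarrow> 0) at_bot"
  proof (rule Lim_null_comparison)
    show "\<forall>\<^sub>F a in at_bot. norm (V a) \<le> C * exp (\<delta> * a) * (pi - (-pi))"
      using eventually_le_at_bot[of B] eventually_gt_at_bot[of "Re w0"]
    proof eventually_elim
      case (elim a)
      show ?case
        unfolding V_def
      proof (rule integral_bound)
        show "continuous_on {- pi..pi} (\<lambda>y. f (Complex a y))"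
          by (rule continuous_on_compose2[OF cont])
            (use elim kap in \<open>auto simp: S_def Complex_eq intro!: continuous_intros\<close>)
      qed (use bound[of "Complex a _"] elim in auto)
    qed
    have "((\<lambda>a. exp (\<delta> * a)) \<longlongrightarrow> 0) at_bot"
      using \<open>\<delta> > 0\<close> by (intro filterlim_compose[OF exp_at_bot]
          filterlim_tendsto_pos_mult_at_bot[OF tendsto_const] filterlim_ident) auto
    then show "((\<lambda>a. C * exp (\<delta> * a) * (pi - (-pi))) \<longlongrightarrow> 0) at_bot"
      by (intro tendsto_mult_left_zero tendsto_mult_right_zero)
  qed
  then have "((\<lambda>a. 2 * pi * \<i> * residue f w0 + \<i> * V a + (LINT x:{a..}|lborel. branch_jump f x))
     \<longlongrightarrow> 2 * pi * \<i> * residue f w0 + \<i> * 0 + (LINT x|lborel. branch_jump f x)) at_bot"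
    by (intro tendsto_intros tendsto_LINT_atLeast_at_bot int)
  \<comment> \<open>By \<open>shift\<close> the expression under the limit does not depend on
    \<open>a\<close>, so its value equals the limit.\<close>
  then have "((\<lambda>a::real. hankel b f) \<longlongrightarrow> 2 * pi * \<i> * residue f w0 + \<i> * 0 + (LINT x|lborel. branch_jump f x)) at_bot"
  proof (rule Lim_transform_eventually)
    show "\<forall>\<^sub>F a in at_bot. 2 * pi * \<i> * residue f w0 + \<i> * V a + (LINT x:{a..}|lborel. branch_jump f x) = hankel b f"
      using eventually_gt_at_bot[of "Re w0"] by eventually_elim (rule shift[symmetric])
  qed
  then show ?thesis
    by (simp add: tendsto_const_iff)
qed

subsection \<open>Hankel's formula for the reciprocal Gamma function\<close>

text \<open>Integrals of non-integrable functions have default values, so linearity of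
  \<open>hankel\<close> rests on this condition. As in \<open>hankel\<close>, it is the jump that
  has to be integrable along the rays.\<close>

definition hankel_integrable :: "real \<Rightarrow> (complex \<Rightarrow> complex) \<Rightarrow> bool" where
  "hankel_integrable b f \<longleftrightarrow>
     (\<lambda>y. f (Complex b y)) integrable_on {-pi..pi} \<and> set_integrable lborel {b..} (branch_jump f)"

lemma hankel_diff:
  assumes "hankel_integrable b f" "hankel_integrable b g"
  shows "hankel b (\<lambda>w. f w - g w) = hankel b f - hankel b g"
proof -
  have eq: "branch_jump (\<lambda>w. f w - g w) = (\<lambda>x. branch_jump f x - branch_jump g x)"
    by (auto simp: branch_jump_def fun_eq_iff)
  show ?thesis
    using assms unfolding hankel_def eq hankel_integrable_def
    by (simp add: Henstock_Kurzweil_Integration.integral_diff set_integral_diff algebra_simps)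
qed

lemma
  assumes "hankel_integrable b f"
  shows hankel_integrable_cmult: "hankel_integrable b (\<lambda>w. c * f w)"
    and hankel_cmult: "hankel b (\<lambda>w. c * f w) = c * hankel b f"
proof -
  have eq: "branch_jump (\<lambda>w. c * f w) = (\<lambda>x. c * branch_jump f x)"
    by (auto simp: branch_jump_def fun_eq_iff algebra_simps)
  show "hankel_integrable b (\<lambda>w. c * f w)" "hankel b (\<lambda>w. c * f w) = c * hankel b f"
    using assms unfolding hankel_def eq hankel_integrable_def
    by (auto simp: algebra_simps intro!: integrable_on_mult_right)
qed

lemma
  assumes "finite I" "\<And>k. k \<in> I \<Longrightarrow> hankel_integrable b (f k)"
  shows hankel_integrable_sum: "hankel_integrable b (\<lambda>w. \<Sum>k\<in>I. f k w)"
    and hankel_sum: "hankel b (\<lambda>w. \<Sum>k\<in>I. f k w) = (\<Sum>k\<in>I. hankel b (f k))"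
proof -
  have eq: "branch_jump (\<lambda>w. \<Sum>k\<in>I. f k w) = (\<lambda>x. \<Sum>k\<in>I. branch_jump (f k) x)"
    by (auto simp: branch_jump_def fun_eq_iff sum_subtractf)
  have int: "set_integrable lborel {b..} (\<lambda>x. branch_jump (f k) x)" if "k \<in> I" for k
    using assms that by (auto simp: hankel_integrable_def)
  have "integrable lborel (\<lambda>x. \<Sum>k\<in>I. indicat_real {b..} x *\<^sub>R branch_jump (f k) x)"
    using int unfolding set_integrable_def by (intro Bochner_Integration.integrable_sum) auto
  then have s: "set_integrable lborel {b..} (\<lambda>x. \<Sum>k\<in>I. branch_jump (f k) x)"
    by (simp add: set_integrable_def scaleR_sum_right)
  have "(LINT x:{b..}|lborel. \<Sum>k\<in>I. branch_jump (f k) x) = (\<Sum>k\<in>I. LINT x:{b..}|lborel. branch_jump (f k) x)"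
    using int unfolding set_lebesgue_integral_def set_integrable_def scaleR_sum_right
    by (subst Bochner_Integration.integral_sum) auto
  then show "hankel_integrable b (\<lambda>w. \<Sum>k\<in>I. f k w)" "hankel b (\<lambda>w. \<Sum>k\<in>I. f k w) = (\<Sum>k\<in>I. hankel b (f k))"
    using assms s unfolding hankel_def eq hankel_integrable_def
    by (auto simp: Henstock_Kurzweil_Integration.integral_sum sum.distrib sum_distrib_left intro!: integrable_sum)
qed

section \<open>The integrands exp (exp w + c w)\<close>

lemma norm_exp_exp_le:
  "norm (exp (exp w + of_real c * w)) \<le> exp (exp (Re w)) * exp (c * Re w)"
proof -
  have "exp (Re w) * cos (Im w) \<le> exp (Re w)"
    by simp
  then show ?thesis
    by (simp add: norm_exp_eq_Re Re_exp exp_add[symmetric] del: exp_add)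
qed

lemma exp_Complex_pi:
  "exp (Complex x pi) = - of_real (exp x)" "exp (Complex x (-pi)) = - of_real (exp x)"
  by (simp_all add: complex_eq_iff Re_exp Im_exp)

lemma exp_exp_branch:
  "exp (exp (Complex x pi) + of_real c * Complex x pi) = of_real (exp (c * x - exp x)) * cis (c * pi)"
  "exp (exp (Complex x (-pi)) + of_real c * Complex x (-pi)) = of_real (exp (c * x - exp x)) * cis (- (c * pi))"
  by (simp_all add: exp_Complex_pi complex_eq_iff Re_exp Im_exp)

lemma branch_jump_exp_exp:
  "branch_jump (\<lambda>w. exp (exp w + of_real c * w)) x = of_real (exp (c * x - exp x)) * (2 * \<i> * of_real (sin (c * pi)))"
  by (simp add: branch_jump_def exp_exp_branch complex_eq_iff)

lemma has_bochner_integral_branch_jump_exp_exp: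
  assumes "c > 0"
  shows "has_bochner_integral lborel (branch_jump (\<lambda>w. exp (exp w + of_real c * w)))
    (of_real (Gamma c) * (2 * \<i> * of_real (sin (c * pi))))"
  unfolding branch_jump_exp_exp[abs_def]
  by (intro has_bochner_integral_mult_left has_bochner_integral_of_real has_bochner_integral_exp_minus_exp assms)

lemma hankel_integrable_exp_exp: "hankel_integrable b (\<lambda>w. exp (exp w + of_real c * w))"
  unfolding hankel_integrable_def branch_jump_exp_exp[abs_def]
proof (intro conjI)
  show "(\<lambda>y. exp (exp (Complex b y) + of_real c * Complex b y)) integrable_on {-pi..pi}"
    by (intro integrable_continuous_real) (auto simp: Complex_eq intro!: continuous_intros)
  have "set_integrable lborel {b..} (\<lambda>x. of_real (exp (c * x - exp x)) :: complex)"
    using integrable_of_real[OF set_integrable_exp_minus_exp[of b c, unfolded set_integrable_def], where ?'a = complex]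
    by (simp add: set_integrable_def scaleR_conv_of_real)
  then show "set_integrable lborel {b..} (\<lambda>x. of_real (exp (c * x - exp x)) * (2 * \<i> * of_real (sin (c * pi))))"
    by (intro set_integrable_mult_left) auto
qed

text \<open>Euler's reflection formula; for \<open>x < 1\<close> the value
  \<open>Gamma (1 - x)\<close> is positive, so \<open>rGamma (1 - x)\<close> can be divided out. The
  sine is kept at \<open>1 - x\<close> to match the factor in \<open>branch_jump_exp_exp\<close> for
  \<open>c = 1 - x\<close>.\<close>

lemma rGamma_reflection_real: "rGamma (x :: real) = sin (pi * (1 - x)) / pi * Gamma (1 - x)" if "x < 1"
proof -
  have "complex_of_real (rGamma x * rGamma (1 - x)) = of_real (sin (pi * x) / pi)"
    using rGamma_reflection_complex[of "of_real x"]
    by (simp add: rGamma_complex_of_real[symmetric] sin_of_real[symmetric])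
  then have "rGamma x * rGamma (1 - x) = sin (pi * x) / pi"
    unfolding of_real_eq_iff .
  moreover have "rGamma (1 - x) = 1 / Gamma (1 - x)" "Gamma (1 - x) > 0"
    using that by (auto simp: rGamma_inverse_Gamma divide_inverse)
  ultimately show ?thesis
    by (simp add: field_simps sin_diff)
qed

text \<open>For \<open>\<beta> < 1\<close> the integrand decays to the left, so the contour
  collapses onto the cut without meeting a pole. The jump integrates to
  \<open>Gamma (1 - \<beta>)\<close> times a sine, and reflection turns this into
  \<open>rGamma \<beta>\<close>.\<close>

lemma hankel_exp_exp_less_1:
  assumes "\<beta> < 1"
  shows "hankel b (\<lambda>w. exp (exp w + of_real (1 - \<beta>) * w)) = 2 * pi * \<i> * of_real (rGamma \<beta>)"
proof -
  let ?f = "\<lambda>w. exp (exp w + of_real (1 - \<beta>) * w)"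
  have holo: "?f holomorphic_on A" for A
    by (intro holomorphic_intros)
  have int: "has_bochner_integral lborel (branch_jump ?f)
      (of_real (Gamma (1 - \<beta>)) * (2 * \<i> * of_real (sin ((1 - \<beta>) * pi))))"
    using assms by (intro has_bochner_integral_branch_jump_exp_exp) auto
  \<comment> \<open>The integrand is entire; \<open>b - 1\<close> is a point of the strip to the
    left of the segment, with residue 0.\<close>
  have "hankel b ?f = 2 * pi * \<i> * residue ?f (of_real (b - 1)) + (LINT x|lborel. branch_jump ?f x)"
  proof (rule hankel_eq_residue_plus_LINT[where kap = "2 * pi" and \<delta> = "1 - \<beta>" and B = 0 and C = "exp 1"])
    fix w :: complex assume "Re w \<le> 0" 
    then have "exp (exp (Re w)) * exp ((1 - \<beta>) * Re w) \<le> exp 1 * exp ((1 - \<beta>) * Re w)"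
      by (intro mult_right_mono) auto
    then show "norm (?f w) \<le> exp 1 * exp ((1 - \<beta>) * Re w)"
      using norm_exp_exp_le[of w "1 - \<beta>"] by linarith
  qed (use assms int holo in \<open>auto simp: has_bochner_integral_iff\<close>)
  also have "residue ?f (of_real (b - 1)) = 0"
    by (rule residue_holo[OF open_UNIV UNIV_I holo])
  also have "(LINT x|lborel. branch_jump ?f x) = of_real (Gamma (1 - \<beta>)) * (2 * \<i> * of_real (sin ((1 - \<beta>) * pi)))"
    using int by (simp add: has_bochner_integral_iff)
  finally show ?thesis
    using rGamma_reflection_real[OF assms] by (simp add: mult_ac)
qed

text \<open>The recurrence below gives no information at \<open>\<beta> = 1\<close>, where its factor vanishes.\<close>

lemma hankel_exp_exp_1: "hankel b (\<lambda>w. exp (exp w)) = 2 * pi * \<i>"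
proof -
  \<comment> \<open>As Re w -> -infinity, exp (exp w) tends to 1, so subtracting 1 creates the decay
    needed for the shift. Both functions have period 2 pi i, hence no jump, and the subtracted 1
    returns as the length 2 pi of the segment.\<close>
  let ?f = "\<lambda>w. exp (exp w) - 1 :: complex"
  have holo: "?f holomorphic_on A" for A
    by (intro holomorphic_intros)
  have jump: "branch_jump ?f = (\<lambda>_. 0)" "branch_jump (\<lambda>w. exp (exp w)) = (\<lambda>_. 0)"
    by (auto simp: branch_jump_def exp_Complex_pi)
  have "hankel b ?f = 2 * pi * \<i> * residue ?f (of_real (b - 1)) + (LINT x|lborel. branch_jump ?f x)"
  proof (rule hankel_eq_residue_plus_LINT[where kap = "2 * pi" and \<delta> = "1" and B = 0 and C = "exp 1"])
    fix w :: complex assume w: "Re w \<le> 0"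
    have "norm (exp (exp w) - (\<Sum>i\<le>0. exp w ^ i / fact i)) \<le> exp \<bar>Re (exp w)\<bar> * norm (exp w) ^ Suc 0 / fact 0"
      by (rule Taylor_exp)
    also have "\<dots> \<le> exp 1 * exp (1 * Re w)"
    proof -
      have "\<bar>Re (exp w)\<bar> \<le> 1"
        using w abs_Re_le_cmod[of "exp w"] by (simp add: order_trans[of _ "exp (Re w)"])
      then show ?thesis by simp
    qed
    finally show "norm (?f w) \<le> exp 1 * exp (1 * Re w)"
      by simp
  qed (use holo jump in auto)
  also have "residue ?f (of_real (b - 1)) = 0"
    by (rule residue_holo[OF open_UNIV UNIV_I holo])
  finally have "integral {-pi..pi} (\<lambda>y. exp (exp (Complex b y)) - 1) = 0"
    by (simp add: jump hankel_def)
  moreover have "integral {-pi..pi} (\<lambda>y. exp (exp (Complex b y)) - 1) =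
     integral {-pi..pi} (\<lambda>y. exp (exp (Complex b y))) - integral {-pi..pi} (\<lambda>y. 1)"
    by (intro Henstock_Kurzweil_Integration.integral_diff integrable_continuous_real)
       (auto simp: Complex_eq intro!: continuous_intros)
  ultimately show ?thesis
    by (simp add: hankel_def jump scaleR_conv_of_real)
qed

text \<open>Integration by parts: exp (exp w - \<beta> w) is a primitive of the difference of the
  two integrands, and its jump vanishes at the far end of the rays.\<close>

lemma hankel_exp_exp_rec:
  "hankel b (\<lambda>w. exp (exp w + of_real (1 - \<beta>) * w)) = of_real \<beta> * hankel b (\<lambda>w. exp (exp w + of_real (- \<beta>) * w))"
proof -
  let ?G = "\<lambda>w. exp (exp w + of_real (- \<beta>) * w)"
  let ?g = "\<lambda>w. exp (exp w + of_real (1 - \<beta>) * w) - of_real \<beta> * ?G w"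
  have deriv: "(?G has_field_derivative ?g w) (at w within A)" for w A
  proof -
    have "(?G has_field_derivative ?G w * (exp w + of_real (- \<beta>))) (at w within A)"
      by (auto intro!: derivative_eq_intros)
    moreover have "exp (exp w + of_real (1 - \<beta>) * w) = exp w * ?G w"
      unfolding exp_add[symmetric] by (simp add: algebra_simps)
    ultimately show ?thesis
      by (simp add: algebra_simps)
  qed
  have hi: "hankel_integrable b (\<lambda>w. exp (exp w + of_real (1 - \<beta>) * w))" "hankel_integrable b (\<lambda>w. of_real \<beta> * ?G w)"
    by (intro hankel_integrable_exp_exp hankel_integrable_cmult)+
  \<comment> \<open>Along the segment the primitive changes by its jump at \<open>b\<close>; along
    the rays the jump runs from that value to 0. The two contributions cancel.\<close>
  have "((\<lambda>y. \<i> * ?g (Complex b y)) has_integral ?G (Complex b pi) - ?G (Complex b (-pi))) {-pi..pi}"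
  proof (rule fundamental_theorem_of_calculus)
    fix y :: real
    have "((\<lambda>y. Complex b y) has_vector_derivative \<i>) (at y within {-pi..pi})"
      unfolding Complex_eq by (auto intro!: derivative_eq_intros)
    from field_vector_diff_chain_within[OF this deriv]
    show "((\<lambda>y. ?G (Complex b y)) has_vector_derivative \<i> * ?g (Complex b y)) (at y within {-pi..pi})"
      by (simp add: o_def)
  qed simp
  then have 1: "\<i> * integral {-pi..pi} (\<lambda>y. ?g (Complex b y)) = branch_jump ?G b"
    by (simp add: integral_unique branch_jump_def flip: integral_mult_right)
  have "(LBINT x=ereal b..\<infinity>. branch_jump ?g x) = 0 - branch_jump ?G b"
  proof (rule interval_integral_FTC_integrable[where F = "branch_jump ?G"])
    fix x :: real
    have "((\<lambda>x. Complex x y) has_vector_derivative 1) (at x)" for y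
      unfolding Complex_eq by (auto intro!: derivative_eq_intros)
    from field_vector_diff_chain_at[OF this deriv]
    have "((\<lambda>x. ?G (Complex x y)) has_vector_derivative ?g (Complex x y)) (at x)" for y
      by (simp add: o_def)
    then show "(branch_jump ?G has_vector_derivative branch_jump ?g x) (at x)"
      unfolding branch_jump_def[abs_def] by (intro has_vector_derivative_diff)
    show "isCont (branch_jump ?g) x"
      unfolding branch_jump_def[abs_def] Complex_eq by (intro continuous_intros)
  next
    have "branch_jump ?g = (\<lambda>x. branch_jump (\<lambda>w. exp (exp w + of_real (1 - \<beta>) * w)) x - branch_jump (\<lambda>w. of_real \<beta> * ?G w) x)"
      by (auto simp: branch_jump_def fun_eq_iff)
    then have "set_integrable lborel {b..} (branch_jump ?g)"
      using hi by (auto simp: hankel_integrable_def intro!: set_integral_diff)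
    then show "set_integrable lborel (einterval (ereal b) \<infinity>) (branch_jump ?g)"
      by (rule set_integrable_subset) (auto simp: einterval_def)
  next
    have "isCont (branch_jump ?G) b"
      unfolding branch_jump_def[abs_def] Complex_eq by (intro continuous_intros)
    then have "(branch_jump ?G \<longlongrightarrow> branch_jump ?G b) (at_right b)"
      by (simp add: isCont_def filterlim_at_split)
    then show "((branch_jump ?G \<circ> real_of_ereal) \<longlongrightarrow> branch_jump ?G b) (at_right (ereal b))"
      by (simp add: ereal_tendsto_simps)
  next
    have "((\<lambda>x. exp ((- \<beta>) * x - exp x)) \<longlongrightarrow> 0) at_top"
      by real_asymp
    then have "(branch_jump ?G \<longlongrightarrow> of_real 0 * (2 * \<i> * of_real (sin ((- \<beta>) * pi)))) at_top"
      unfolding branch_jump_exp_exp[abs_def] by (intro tendsto_intros)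
    then show "((branch_jump ?G \<circ> real_of_ereal) \<longlongrightarrow> 0) (at_left \<infinity>)"
      by (simp add: ereal_tendsto_simps)
  qed auto
  moreover have "(LBINT x=ereal b..\<infinity>. branch_jump ?g x) = (LINT x:{b..}|lborel. branch_jump ?g x)"
    unfolding interval_integral_to_infinity_eq set_lebesgue_integral_def
    by (rule integral_discrete_difference[of "{b}"]) (auto simp: indicator_def)
  ultimately have 2: "(LINT x:{b..}|lborel. branch_jump ?g x) = - branch_jump ?G b"
    by (simp only: diff_0)
  have "hankel b ?g = 0"
    unfolding hankel_def 1 2 by simp
  then show ?thesis
    using hankel_diff[OF hi] hankel_cmult[OF hankel_integrable_exp_exp[of b "- \<beta>"], of "of_real \<beta>"]
      \<open>hankel b ?g = 0\<close> by simp
qed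

text \<open>Starting from \<open>\<beta> < 1\<close>, the recurrence at \<open>\<beta> - 1\<close>
  moves up by one: both it and the functional equation of \<open>rGamma\<close> carry the factor
  \<open>\<beta> - 1\<close>, which is cancelled. The value 1, where this factor is 0, comes from
  \<open>hankel_exp_exp_1\<close>.\<close>

lemma hankel_exp_exp: "hankel b (\<lambda>w. exp (exp w + of_real (1 - \<beta>) * w)) = 2 * pi * \<i> * of_real (rGamma \<beta>)"
proof -
  have "\<beta> < 1 + real n \<Longrightarrow> ?thesis" for n
  proof (induction n arbitrary: \<beta>)
    case 0
    then show ?case using hankel_exp_exp_less_1 by simp
  next
    case (Suc n)
    show ?case
    proof (cases "\<beta> = 1")
      case True
      then show ?thesis using hankel_exp_exp_1[of b] by simp
    next
      case False
      have "of_real (\<beta> - 1) * hankel b (\<lambda>w. exp (exp w + of_real (1 - \<beta>) * w)) =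
          2 * pi * \<i> * of_real (rGamma (\<beta> - 1))"
      proof -
        have "\<beta> - 1 < 1 + real n"
          using Suc.prems by simp
        from hankel_exp_exp_rec[of b "\<beta> - 1", unfolded minus_diff_eq] Suc.IH[OF this] show ?thesis
          by (simp only:)
      qed
      also have "rGamma (\<beta> - 1) = (\<beta> - 1) * rGamma \<beta>"
        using rGamma_plus1[of "\<beta> - 1"] by simp
      finally have "of_real (\<beta> - 1) * hankel b (\<lambda>w. exp (exp w + of_real (1 - \<beta>) * w)) =
          of_real (\<beta> - 1) * (2 * pi * \<i> * of_real (rGamma \<beta>))"
        by (simp only: of_real_mult mult_ac)
      moreover have "complex_of_real (\<beta> - 1) \<noteq> 0"
        using False by (subst of_real_eq_0_iff) simp
      ultimately show ?thesis
        using mult_left_cancel by blast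
    qed
  qed
  moreover obtain n where "\<beta> < real n" using reals_Archimedean2 by blast
  then have "\<beta> < 1 + real n" by simp
  ultimately show ?thesis by blast
qed

subsection \<open>The contour integral of the Mittag-Leffler function\<close>

text \<open>On the rays the integrand is compared with \<open>B\<close> times a fixed integrable
  profile, so the Hankel integral tends to 0 along with \<open>A\<close> and \<open>B\<close>. This
  disposes of the remainder of the geometric series.\<close>

lemma
  assumes cont: "continuous_on {w. b \<le> Re w \<and> \<bar>Im w\<bar> \<le> pi} f"
    and segment: "\<And>w. Re w = b \<Longrightarrow> \<bar>Im w\<bar> \<le> pi \<Longrightarrow> norm (f w) \<le> A"
    and rays: "\<And>w. b \<le> Re w \<Longrightarrow> \<bar>Im w\<bar> = pi \<Longrightarrow> norm (f w) \<le> B * exp (c * Re w - exp (Re w))"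
  shows hankel_integrableI: "hankel_integrable b f"
    and norm_hankel_le: "norm (hankel b f) \<le> 2 * pi * A + 2 * B * (LINT x:{b..}|lborel. exp (c * x - exp x))"
proof -
  have contv: "continuous_on {-pi..pi} (\<lambda>y. f (Complex b y))"
    by (rule continuous_on_compose2[OF cont]) (auto simp: Complex_eq intro!: continuous_intros)
  have contj: "continuous_on {b..} (branch_jump f)"
    unfolding branch_jump_def
    by (intro continuous_on_diff continuous_on_compose2[OF cont]) (auto simp: Complex_eq intro!: continuous_intros)
  have int: "integrable lborel (\<lambda>x. 2 * B * (indicat_real {b..} x *\<^sub>R exp (c * x - exp x)))"
    using set_integrable_exp_minus_exp[of b c] by (auto simp: set_integrable_def)
  have jump: "norm (indicat_real {b..} x *\<^sub>R branch_jump f x) \<le> 2 * B * (indicat_real {b..} x *\<^sub>R exp (c * x - exp x))" for x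
  proof (cases "x \<ge> b")
    case True
    have "norm (branch_jump f x) \<le> norm (f (Complex x pi)) + norm (f (Complex x (-pi)))"
      unfolding branch_jump_def by (rule norm_triangle_ineq4)
    also have "\<dots> \<le> B * exp (c * x - exp x) + B * exp (c * x - exp x)"
      using rays[of "Complex x pi"] rays[of "Complex x (-pi)"] True by (intro add_mono) auto
    finally show ?thesis using True by simp
  qed auto
  have intj: "integrable lborel (\<lambda>x. indicat_real {b..} x *\<^sub>R branch_jump f x)"
  proof (rule Bochner_Integration.integrable_bound[OF int])
    show "(\<lambda>x. indicat_real {b..} x *\<^sub>R branch_jump f x) \<in> borel_measurable lborel"
      using borel_measurable_continuous_on_indicator[OF _ contj] by simp
    show "AE x in lborel. norm (indicat_real {b..} x *\<^sub>R branch_jump f x)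
        \<le> norm (2 * B * (indicat_real {b..} x *\<^sub>R exp (c * x - exp x)))"
      using jump by (intro AE_I2 order_trans[OF jump]) auto
  qed
  then show "hankel_integrable b f"
    using contv by (auto simp: hankel_integrable_def set_integrable_def intro!: integrable_continuous_real)
  have "norm (integral {-pi..pi} (\<lambda>y. f (Complex b y))) \<le> 2 * pi * A"
  proof -
    have "norm (integral {-pi..pi} (\<lambda>y. f (Complex b y))) \<le> A * (pi - (-pi))"
      by (rule integral_bound[OF _ contv]) (auto intro!: segment)
    then show ?thesis by (simp add: mult_ac)
  qed
  moreover have "norm (LINT x:{b..}|lborel. branch_jump f x) \<le> 2 * B * (LINT x:{b..}|lborel. exp (c * x - exp x))"
    unfolding set_lebesgue_integral_def using Bochner_Integration.integral_norm_bound_integral[OF intj int jump] by simp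
  ultimately have "norm (\<i> * integral {-pi..pi} (\<lambda>y. f (Complex b y))) + norm (LINT x:{b..}|lborel. branch_jump f x)
      \<le> 2 * pi * A + 2 * B * (LINT x:{b..}|lborel. exp (c * x - exp x))"
    unfolding norm_mult norm_ii by linarith
  then show "norm (hankel b f) \<le> 2 * pi * A + 2 * B * (LINT x:{b..}|lborel. exp (c * x - exp x))"
    unfolding hankel_def by (rule order_trans[OF norm_triangle_ineq])
qed

text \<open>The Hankel integrands of the Mittag-Leffler terms form a geometric series with ratio z
  exp (- \<alpha> w). Its sum is expanded by exp (\<alpha> w), whence the additional \<alpha> in the
  exponent.\<close>

definition ml_kernel :: "real \<Rightarrow> real \<Rightarrow> complex \<Rightarrow> complex \<Rightarrow> complex" where
  "ml_kernel \<alpha> \<beta> z w = exp (exp w + of_real (1 + \<alpha> - \<beta>) * w) / (exp (of_real \<alpha> * w) - z)"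

lemma norm_exp_exp_ray:
  assumes "\<bar>Im w\<bar> = pi"
  shows "norm (exp (exp w + of_real c * w)) = exp (c * Re w - exp (Re w))"
proof -
  have "w = Complex (Re w) pi \<or> w = Complex (Re w) (-pi)"
    using assms by (auto simp: complex_eq_iff abs_if split: if_splits)
  then have "cos (Im w) = - 1"
    by (metis assms cos_abs_real cos_pi)
  then show ?thesis
    by (simp add: norm_exp_eq_Re Re_exp)
qed

text \<open>The condition on \<open>b\<close> keeps the ratio z exp (- \<alpha> w) below some
  \<open>r < 1\<close> in modulus on the whole contour. The geometric remainder is then of size
  \<open>r ^ n\<close>, and Hankel's formula evaluates the terms one by one.\<close>

lemma mittag_leffler_eq_hankel:
  assumes "\<alpha> > 0" and z: "norm z < exp (\<alpha> * b)"
  shows "hankel b (ml_kernel \<alpha> \<beta> z) = 2 * pi * \<i> * mittag_leffler \<alpha> \<beta> z"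
proof -
  define E where "E w = exp (exp w + of_real (1 - \<beta>) * w)" for w :: complex
  define q where "q w = z * exp (- (of_real \<alpha> * w))" for w :: complex
  define r where "r = norm z * exp (- (\<alpha> * b))"
  define e where "e k w = exp (exp w + of_real (1 - (real k * \<alpha> + \<beta>)) * w)" for k and w :: complex
  \<comment> \<open>With \<open>E\<close> the common factor and \<open>q\<close> the ratio, the k-th
    term is \<open>E w * q w ^ k\<close>, and \<open>D n\<close> is the remainder after n
    terms.\<close>
  define D where "D n w = ml_kernel \<alpha> \<beta> z w - (\<Sum>k<n. z ^ k * e k w)" for n w
  have r: "0 \<le> r" "r < 1"
    using z by (auto simp: r_def exp_minus field_simps)
  have q_le: "norm (q w) \<le> r" if "b \<le> Re w" for w
    using that \<open>\<alpha> > 0\<close> by (auto simp: q_def r_def norm_mult norm_exp_eq_Re intro!: mult_left_mono)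
  have nz: "exp (of_real \<alpha> * w) - z \<noteq> 0" if "b \<le> Re w" for w
  proof
    assume "exp (of_real \<alpha> * w) - z = 0"
    then have "norm z = exp (\<alpha> * Re w)"
      by (auto simp: norm_exp_eq_Re)
    moreover have "\<alpha> * b \<le> \<alpha> * Re w"
      using that \<open>\<alpha> > 0\<close> by simp
    ultimately show False using z by simp
  qed
  have q_ne: "q w \<noteq> 1" if "b \<le> Re w" for w
    using q_le[OF that] r by auto
  have kernel: "ml_kernel \<alpha> \<beta> z w = E w / (1 - q w)" if "b \<le> Re w" for w
  proof -
    have "exp (exp w + of_real (1 + \<alpha> - \<beta>) * w) = E w * exp (of_real \<alpha> * w)"
      unfolding E_def exp_add[symmetric] by (simp add: algebra_simps)
    moreover have "1 - q w = (exp (of_real \<alpha> * w) - z) / exp (of_real \<alpha> * w)"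
      by (simp add: q_def exp_minus field_simps)
    ultimately show ?thesis
      by (simp add: ml_kernel_def)
  qed
  have e_eq: "z ^ k * e k w = E w * q w ^ k" for k w
  proof -
    have "e k w = E w * exp (- (of_real \<alpha> * w)) ^ k"
      unfolding e_def E_def exp_of_nat_mult[symmetric] exp_add[symmetric] by (simp add: algebra_simps)
    then show ?thesis by (simp add: q_def power_mult_distrib)
  qed
  have D_eq: "D n w = E w * q w ^ n / (1 - q w)" if "b \<le> Re w" for n w
  proof -
    have "(\<Sum>k<n. z ^ k * e k w) = E w * ((q w ^ n - 1) / (q w - 1))"
      unfolding e_eq sum_distrib_left[symmetric] using q_ne[OF that] by (simp add: geometric_sum)
    then show ?thesis
      using q_ne[OF that] by (simp add: D_def kernel[OF that] field_simps)
  qed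
  have D_le: "norm (D n w) \<le> r ^ n / (1 - r) * norm (E w)" if "b \<le> Re w" for n w
  proof -
    have "1 - r \<le> norm (1 - q w)"
      using norm_triangle_ineq2[of 1 "q w"] q_le[OF that] by simp
    moreover have "norm (q w ^ n) \<le> r ^ n"
      using q_le[OF that] by (simp add: norm_power power_mono)
    ultimately have "norm (q w ^ n) / norm (1 - q w) \<le> r ^ n / (1 - r)"
      using r by (intro frac_le) auto
    then have "norm (E w) * (norm (q w ^ n) / norm (1 - q w)) \<le> norm (E w) * (r ^ n / (1 - r))"
      by (rule mult_left_mono) simp
    then show ?thesis
      by (simp add: D_eq[OF that] norm_mult norm_divide mult_ac)
  qed
  have e_int: "hankel_integrable b (\<lambda>w. z ^ k * e k w)" for k
    unfolding e_def by (intro hankel_integrable_cmult hankel_integrable_exp_exp)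
  define A where "A = exp (exp b) * exp ((1 - \<beta>) * b)"
  define K where "K = 2 * pi * (A / (1 - r)) + 2 * (1 / (1 - r)) * (LINT x:{b..}|lborel. exp ((1 - \<beta>) * x - exp x))"
  have D: "hankel_integrable b (D n)" "norm (hankel b (D n)) \<le> r ^ n * K" for n
  proof -
    have cont: "continuous_on {w. b \<le> Re w \<and> \<bar>Im w\<bar> \<le> pi} (D n)"
      unfolding D_def e_def ml_kernel_def using nz by (intro continuous_intros) auto
    have segment: "norm (D n w) \<le> r ^ n / (1 - r) * A" if "Re w = b" for w
      using r norm_exp_exp_le[of w "1 - \<beta>"] that
      by (intro order_trans[OF D_le] mult_left_mono) (auto simp: A_def E_def)
    have rays: "norm (D n w) \<le> r ^ n / (1 - r) * exp ((1 - \<beta>) * Re w - exp (Re w))"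
      if "b \<le> Re w" "\<bar>Im w\<bar> = pi" for w
      using D_le[OF that(1), of n] unfolding E_def norm_exp_exp_ray[OF that(2)] .
    show "hankel_integrable b (D n)"
      by (rule hankel_integrableI[OF cont segment rays])
    have "norm (hankel b (D n)) \<le> 2 * pi * (r ^ n / (1 - r) * A)
        + 2 * (r ^ n / (1 - r)) * (LINT x:{b..}|lborel. exp ((1 - \<beta>) * x - exp x))"
      by (rule norm_hankel_le[OF cont segment rays])
    then show "norm (hankel b (D n)) \<le> r ^ n * K"
      by (simp add: K_def algebra_simps)
  qed
  have "D 0 = ml_kernel \<alpha> \<beta> z"
    by (auto simp: D_def)
  then have k_int: "hankel_integrable b (ml_kernel \<alpha> \<beta> z)"
    using D(1)[of 0] by simp
  let ?t = "\<lambda>k. 2 * pi * \<i> * (z ^ k / of_real (Gamma (real k * \<alpha> + \<beta>)))"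
  \<comment> \<open>This includes the poles of \<open>Gamma\<close>: there \<open>rGamma\<close> is
    0, and \<open>Gamma\<close> has the default value 0, so dividing by it also gives 0.\<close>
  have term_eq: "hankel b (\<lambda>w. z ^ k * e k w) = ?t k" for k
    unfolding e_def hankel_cmult[OF hankel_integrable_exp_exp] hankel_exp_exp
    by (simp add: rGamma_inverse_Gamma divide_inverse)
  have hD: "hankel b (D n) = hankel b (ml_kernel \<alpha> \<beta> z) - (\<Sum>k<n. ?t k)" for n
    unfolding D_def
    by (simp only: hankel_diff[OF k_int hankel_integrable_sum[OF finite_lessThan e_int]]
        hankel_sum[OF finite_lessThan e_int] term_eq)
  have "norm (hankel b (ml_kernel \<alpha> \<beta> z) - (\<Sum>k<n. ?t k)) \<le> r ^ n * K" for n
    using D(2)[of n] by (simp only: hD)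
  moreover have "(\<lambda>n. r ^ n * K) \<longlonglongrightarrow> 0"
    using r by (intro tendsto_mult_left_zero LIMSEQ_power_zero) simp
  ultimately have "(\<lambda>n. hankel b (ml_kernel \<alpha> \<beta> z) - (\<Sum>k<n. ?t k)) \<longlonglongrightarrow> 0"
    by (rule Lim_null_comparison[OF always_eventually[OF allI]])
  \<comment> \<open>Convergence of the Mittag-Leffler series is obtained here together with its
    value.\<close>
  from tendsto_diff[OF tendsto_const[of "hankel b (ml_kernel \<alpha> \<beta> z)"] this]
  have "?t sums hankel b (ml_kernel \<alpha> \<beta> z)"
    by (simp add: sums_def)
  then have "(\<lambda>k. ?t k / (2 * pi * \<i>)) sums (hankel b (ml_kernel \<alpha> \<beta> z) / (2 * pi * \<i>))"
    by (rule sums_divide)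
  then have "mittag_leffler \<alpha> \<beta> z = hankel b (ml_kernel \<alpha> \<beta> z) / (2 * pi * \<i>)"
    by (simp add: mittag_leffler_def sums_iff)
  then show ?thesis by simp
qed

subsection \<open>The pole and the remaining line integrals\<close>

text \<open>On full lines there is no cut-off at \<open>b\<close>; instead \<open>c > 0\<close>
  makes the majorant integrable towards -infinity, and its integral is a Gamma value.\<close>

lemma
  assumes "c > 0" and cont: "continuous_on {w. \<bar>Im w\<bar> = pi} f"
    and rays: "\<And>w. \<bar>Im w\<bar> = pi \<Longrightarrow> norm (f w) \<le> B * exp (c * Re w - exp (Re w))"
  shows integrable_branch_jump: "integrable lborel (branch_jump f)"
    and norm_LINT_branch_jump_le: "norm (LINT x|lborel. branch_jump f x) \<le> 2 * B * Gamma c"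
proof -
  have "continuous_on UNIV (branch_jump f)"
    unfolding branch_jump_def
    by (intro continuous_on_diff continuous_on_compose2[OF cont]) (auto simp: Complex_eq intro!: continuous_intros)
  then have meas: "branch_jump f \<in> borel_measurable lborel"
    using borel_measurable_continuous_onI by simp
  have dom: "has_bochner_integral lborel (\<lambda>x. 2 * B * exp (c * x - exp x)) (2 * B * Gamma c)"
    by (intro has_bochner_integral_mult_right has_bochner_integral_exp_minus_exp assms)
  have jump: "norm (branch_jump f x) \<le> 2 * B * exp (c * x - exp x)" for x
  proof -
    have "norm (branch_jump f x) \<le> norm (f (Complex x pi)) + norm (f (Complex x (-pi)))"
      unfolding branch_jump_def by (rule norm_triangle_ineq4)
    then show ?thesis
      using rays[of "Complex x pi"] rays[of "Complex x (-pi)"] by simp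
  qed
  show int: "integrable lborel (branch_jump f)"
  proof (rule Bochner_Integration.integrable_bound[OF _ meas])
    show "integrable lborel (\<lambda>x. 2 * B * exp (c * x - exp x))"
      using dom by (simp only: has_bochner_integral_iff)
    show "AE x in lborel. norm (branch_jump f x) \<le> norm (2 * B * exp (c * x - exp x))"
      using jump by (intro AE_I2 order_trans[OF jump]) simp
  qed
  show "norm (LINT x|lborel. branch_jump f x) \<le> 2 * B * Gamma c"
    using Bochner_Integration.integral_norm_bound_integral[OF int _ jump] dom
    by (simp only: has_bochner_integral_iff)
qed

text \<open>With u = exp (\<alpha> w), the finite identity 1/(u - z) = u^M / (z^M (u - z)) - (sum
  over k < M of u^k / z^(k+1)) is exact, so large u do no harm. Each factor u raises the exponent by
  \<alpha>, which gives the Gamma arguments; the bound |u - z| >= m controls the remainder.\<close>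

lemma
  assumes "\<alpha> > 0" "\<beta> < 1 + \<alpha>" "z \<noteq> 0" "m > 0"
    and m: "\<And>w. \<bar>Im w\<bar> = pi \<Longrightarrow> m \<le> norm (exp (of_real \<alpha> * w) - z)"
  shows integrable_branch_jump_ml_kernel: "integrable lborel (branch_jump (ml_kernel \<alpha> \<beta> z))"
    and LINT_branch_jump_ml_kernel_expansion:
      "norm ((LINT x|lborel. branch_jump (ml_kernel \<alpha> \<beta> z) x) +
         (\<Sum>k<M. of_real (Gamma (1 + \<alpha> - \<beta> + k * \<alpha>)) * (2 * \<i> * of_real (sin ((1 + \<alpha> - \<beta> + k * \<alpha>) * pi))) / z ^ Suc k))
       \<le> 2 * (1 / (norm z ^ M * m)) * Gamma (1 + \<alpha> - \<beta> + M * \<alpha>)"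
proof -
  define c where "c = 1 + \<alpha> - \<beta>"
  have c: "c + real k * \<alpha> > 0" for k :: nat
    using assms by (simp add: c_def add_pos_nonneg)
  define E where "E k w = exp (exp w + of_real (c + real k * \<alpha>) * w)" for k :: nat and w :: complex
  define R where "R M w = E M w / (z ^ M * (exp (of_real \<alpha> * w) - z))" for M w
  have nz: "exp (of_real \<alpha> * w) \<noteq> z" if "\<bar>Im w\<bar> = pi" for w
    using m[OF that] \<open>m > 0\<close> by auto
  have cont: "continuous_on {w. \<bar>Im w\<bar> = pi} (R M)" for M
    unfolding R_def E_def using nz \<open>z \<noteq> 0\<close> by (intro continuous_intros) auto
  have rays: "norm (R M w) \<le> 1 / (norm z ^ M * m) * exp ((c + M * \<alpha>) * Re w - exp (Re w))"
    if "\<bar>Im w\<bar> = pi" for M w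
  proof -
    have "norm (R M w) = exp ((c + M * \<alpha>) * Re w - exp (Re w)) / (norm z ^ M * norm (exp (of_real \<alpha> * w) - z))"
      unfolding R_def E_def norm_divide norm_exp_exp_ray[OF that] norm_mult norm_power ..
    also have "\<dots> \<le> exp ((c + M * \<alpha>) * Re w - exp (Re w)) / (norm z ^ M * m)"
      using m[OF that] \<open>m > 0\<close> \<open>z \<noteq> 0\<close> by (intro divide_left_mono mult_left_mono mult_pos_pos) auto
    finally show ?thesis by simp
  qed
  note int_R = integrable_branch_jump[OF c cont rays] and norm_R = norm_LINT_branch_jump_le[OF c cont rays]
  have expansion: "ml_kernel \<alpha> \<beta> z w = R M w - (\<Sum>k<M. E k w / z ^ Suc k)" if "\<bar>Im w\<bar> = pi" for M w
  proof -
    define u where "u = exp (of_real \<alpha> * w)"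
    have u: "u - z \<noteq> 0"
      using nz[OF that] by (simp add: u_def)
    have E: "E k w = E 0 w * u ^ k" for k
      unfolding E_def u_def exp_of_nat_mult[symmetric] exp_add[symmetric] by (simp add: algebra_simps)
    \<comment> \<open>The sum telescopes: consecutive remainders differ by
      \<open>E M w / z ^ Suc M\<close>.\<close>
    have geo: "(\<Sum>k<M. E k w / z ^ Suc k) = E M w / (z ^ M * (u - z)) - E 0 w / (u - z)"
    proof (induction M)
      case (Suc M)
      have "E M w / (z ^ M * (u - z)) + E M w / z ^ Suc M = E M w * u / (z ^ Suc M * (u - z))"
        using u \<open>z \<noteq> 0\<close> by (simp add: divide_simps) (simp add: algebra_simps)
      moreover have "E M w * u = E (Suc M) w"
        by (simp add: E[of M] E[of "Suc M"])
      ultimately show ?case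
        by (simp only: sum.lessThan_Suc Suc.IH) (simp add: algebra_simps)
    qed simp
    have "ml_kernel \<alpha> \<beta> z w = E 0 w / (u - z)"
      by (simp add: ml_kernel_def E_def u_def c_def)
    then show ?thesis
      unfolding R_def u_def[symmetric] geo by simp
  qed
  have jump: "branch_jump (ml_kernel \<alpha> \<beta> z) = (\<lambda>x. branch_jump (R M) x - (\<Sum>k<M. branch_jump (E k) x / z ^ Suc k))" for M
    unfolding branch_jump_def fun_eq_iff
    by (simp add: expansion[of _ M] sum_subtractf diff_divide_distrib)
  show "integrable lborel (branch_jump (ml_kernel \<alpha> \<beta> z))"
    unfolding jump[of 0] using int_R[of 0] by simp
  have int_E: "has_bochner_integral lborel (\<lambda>x. \<Sum>k<M. branch_jump (E k) x / z ^ Suc k)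
      (\<Sum>k<M. of_real (Gamma (c + k * \<alpha>)) * (2 * \<i> * of_real (sin ((c + k * \<alpha>) * pi))) / z ^ Suc k)"
    unfolding E_def by (intro has_bochner_integral_sum has_bochner_integral_divide has_bochner_integral_branch_jump_exp_exp c)
  have "(LINT x|lborel. branch_jump (ml_kernel \<alpha> \<beta> z) x) = (LINT x|lborel. branch_jump (R M) x) -
      (\<Sum>k<M. of_real (Gamma (c + k * \<alpha>)) * (2 * \<i> * of_real (sin ((c + k * \<alpha>) * pi))) / z ^ Suc k)"
    unfolding jump[of M] using int_E int_R by (simp add: has_bochner_integral_iff)
  then show "norm ((LINT x|lborel. branch_jump (ml_kernel \<alpha> \<beta> z) x) +
         (\<Sum>k<M. of_real (Gamma (1 + \<alpha> - \<beta> + k * \<alpha>)) * (2 * \<i> * of_real (sin ((1 + \<alpha> - \<beta> + k * \<alpha>) * pi))) / z ^ Suc k))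
       \<le> 2 * (1 / (norm z ^ M * m)) * Gamma (1 + \<alpha> - \<beta> + M * \<alpha>)"
    unfolding c_def[symmetric] using norm_R[of M] by simp
qed

text \<open>The zeros of exp (\<alpha> w) - z are p + 2 pi i n / \<alpha> with integer n. The bound
  on \<open>Arg z\<close> puts \<open>p\<close> inside the strip, and the spacing 2 pi / \<alpha> >
  2 pi keeps the other zeros out. The residue at \<open>p\<close> is the exponential term.\<close>

lemma mittag_leffler_eq_exp_plus_LINT:
  assumes \<alpha>: "0 < \<alpha>" "\<alpha> < 1" and "\<beta> < 1 + \<alpha>" and z: "z \<noteq> 0" "\<bar>Arg z\<bar> < pi * \<alpha>"
    and int: "integrable lborel (branch_jump (ml_kernel \<alpha> \<beta> z))"
  defines "p \<equiv> Ln z / of_real \<alpha>"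
  shows "mittag_leffler \<alpha> \<beta> z = exp (exp p + of_real (1 - \<beta>) * p) / of_real \<alpha>
    + (LINT x|lborel. branch_jump (ml_kernel \<alpha> \<beta> z) x) / (2 * pi * \<i>)"
proof -
  define c where "c = 1 + \<alpha> - \<beta>"
  let ?num = "\<lambda>w. exp (exp w + of_real c * w)" and ?den = "\<lambda>w. exp (of_real \<alpha> * w) - z"
  have kernel: "ml_kernel \<alpha> \<beta> z = (\<lambda>w. ?num w / ?den w)"
    by (simp add: ml_kernel_def fun_eq_iff c_def)
  have p_z: "exp (of_real \<alpha> * p) = z"
    using \<alpha> z by (simp add: p_def)
  have Re_p: "\<alpha> * Re p = ln (norm z)" and Im_p: "\<alpha> * Im p = Arg z"
    using \<alpha> z by (auto simp: p_def Arg_eq_Im_Ln)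
  have "\<alpha> * \<bar>Im p\<bar> = \<bar>Arg z\<bar>"
    using \<alpha> by (simp add: Im_p[symmetric] abs_mult)
  then have "\<alpha> * \<bar>Im p\<bar> < \<alpha> * pi"
    using z by (simp add: mult.commute)
  then have Im_p_less: "\<bar>Im p\<bar> < pi"
    using \<alpha> by simp
  \<comment> \<open>Every zero other than \<open>p\<close> has an imaginary part of modulus at least
    this value.\<close>
  define kap where "kap = 2 * pi / \<alpha> - \<bar>Im p\<bar>"
  have "2 * pi < 2 * pi / \<alpha>"
    using \<alpha> by (simp add: field_simps)
  then have kap: "pi < kap"
    using Im_p_less by (simp add: kap_def)
  have den_nz: "?den w \<noteq> 0" if "\<bar>Im w\<bar> < kap" "w \<noteq> p" for w
  proof
    assume "?den w = 0"
    then have "exp (of_real \<alpha> * w) = exp (of_real \<alpha> * p)"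
      by (simp add: p_z)
    then obtain n :: int where n: "of_real \<alpha> * w = of_real \<alpha> * p + (of_int (2 * n) * pi) * \<i>"
      unfolding exp_eq by blast
    have "Im (of_real \<alpha> * w) = Im (of_real \<alpha> * p) + of_int (2 * n) * pi"
      unfolding n by simp
    then have eq: "\<alpha> * (Im w - Im p) = of_int (2 * n) * pi"
      by (simp add: algebra_simps)
    have "\<bar>Im w - Im p\<bar> < 2 * pi / \<alpha>"
      using that by (simp add: kap_def)
    then have "\<alpha> * \<bar>Im w - Im p\<bar> < 2 * pi"
      using \<alpha> by (simp add: field_simps)
    then have "\<bar>\<alpha> * (Im w - Im p)\<bar> < 2 * pi"
      using \<alpha> by (simp only: abs_mult abs_of_pos)
    then have "\<bar>real_of_int n\<bar> < 1"
      unfolding eq by (simp add: abs_mult)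
    then have "n = 0" by linarith
    with n \<alpha> that show False by simp
  qed
  \<comment> \<open>To the left of \<open>B\<close> the modulus of exp (\<alpha> w) is at most
    \<open>norm z / 2\<close>, so the denominator is at least \<open>norm z / 2\<close>.\<close>
  define B where "B = ln (norm z / 2) / \<alpha>"
  have bound: "norm (ml_kernel \<alpha> \<beta> z w) \<le> exp (exp B) / (norm z / 2) * exp (c * Re w)" if "Re w \<le> B" for w
  proof -
    have "\<alpha> * Re w \<le> ln (norm z / 2)"
      using that \<alpha> by (simp add: B_def field_simps)
    then have "exp (\<alpha> * Re w) \<le> norm z / 2"
      using z by (simp add: ln_ge_iff)
    then have den: "norm z / 2 \<le> norm (?den w)"
      using norm_triangle_ineq2[of z "exp (of_real \<alpha> * w)"] by (simp add: norm_exp_eq_Re norm_minus_commute)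
    have "norm (?num w) \<le> exp (exp (Re w)) * exp (c * Re w)"
      by (rule norm_exp_exp_le)
    also have "\<dots> \<le> exp (exp B) * exp (c * Re w)"
      using that by simp
    finally have "norm (?num w) / norm (?den w) \<le> exp (exp B) * exp (c * Re w) / (norm z / 2)"
      using den z by (intro frac_le) auto
    then show ?thesis
      by (simp add: kernel norm_divide mult_ac)
  qed
  \<comment> \<open>The abscissa \<open>Re p + 1\<close> suits both representations: it lies to the
    right of the pole, and \<open>exp (\<alpha> * (Re p + 1))\<close> exceeds
    \<open>norm z\<close>.\<close>
  have "hankel (Re p + 1) (ml_kernel \<alpha> \<beta> z) =
      2 * pi * \<i> * residue (ml_kernel \<alpha> \<beta> z) p + (LINT x|lborel. branch_jump (ml_kernel \<alpha> \<beta> z) x)"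
  proof (rule hankel_eq_residue_plus_LINT[OF kap _ Im_p_less _ _ _ int])
    show "ml_kernel \<alpha> \<beta> z holomorphic_on {w. \<bar>Im w\<bar> < kap} - {p}"
      unfolding kernel using den_nz by (intro holomorphic_intros) auto
    show "norm (ml_kernel \<alpha> \<beta> z w) \<le> exp (exp B) / (norm z / 2) * exp (c * Re w)" if "Re w \<le> B" for w
      by (rule bound[OF that])
  qed (use assms in \<open>auto simp: c_def\<close>)
  moreover have "hankel (Re p + 1) (ml_kernel \<alpha> \<beta> z) = 2 * pi * \<i> * mittag_leffler \<alpha> \<beta> z"
  proof (rule mittag_leffler_eq_hankel)
    have "ln (norm z) < \<alpha> * (Re p + 1)"
      using Re_p \<alpha> by (simp add: algebra_simps)
    then show "norm z < exp (\<alpha> * (Re p + 1))"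
      using z by (metis exp_less_mono exp_ln zero_less_norm_iff)
  qed (rule \<alpha>)
  \<comment> \<open>The pole is simple: the denominator has derivative \<alpha> z at
    \<open>p\<close>, and this z cancels the factor exp (\<alpha> p) = z of the numerator.\<close>
  moreover have "residue (ml_kernel \<alpha> \<beta> z) p = exp (exp p + of_real (1 - \<beta>) * p) / of_real \<alpha>"
  proof -
    have "(?den has_field_derivative of_real \<alpha> * z) (at p)"
      by (auto intro!: derivative_eq_intros simp: p_z)
    then have "residue (\<lambda>w. ?num w / ?den w) p = ?num p / (of_real \<alpha> * z)"
      using \<alpha> z p_z by (intro residue_simple_pole_deriv[of _ UNIV]) (auto intro!: holomorphic_intros)
    also have "?num p = exp (exp p + of_real (1 - \<beta>) * p) * z"
      unfolding p_z[symmetric] exp_add[symmetric] by (simp add: c_def p_z algebra_simps)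
    finally show ?thesis
      using z by (simp add: kernel)
  qed
  ultimately show ?thesis
    by (simp add: field_simps)
qed

subsection \<open>Asymptotic expansion\<close>

text \<open>The map exp (\<alpha> w) sends the lines Im w = -pi and Im w = pi to the rays of
  argument - pi \<alpha> and pi \<alpha>, which \<open>lam\<close> avoids. Positive scaling
  preserves these rays, so the distance from \<open>lam * s\<close> to them is at least
  \<open>m * s\<close>, with \<open>m\<close> independent of \<open>s\<close>.\<close>

lemma ray_separation:
  assumes "\<alpha> < 1" "lam \<noteq> 0" "\<bar>Arg lam\<bar> < pi * \<alpha>"
  obtains m where "m > 0"
    and "\<And>w s. \<bar>Im w\<bar> = pi \<Longrightarrow> s > 0 \<Longrightarrow> m * s \<le> norm (exp (of_real \<alpha> * w) - lam * of_real s)"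
proof -
  \<comment> \<open>Each part is a ray with its origin, written as the preimage of the nonnegative
    reals under the rotation onto them; closedness is then immediate.\<close>
  define S where "S = (\<lambda>u. u * cis (- (pi * \<alpha>))) -` \<real>\<^sub>\<ge>\<^sub>0 \<union> (\<lambda>u. u * cis (pi * \<alpha>)) -` \<real>\<^sub>\<ge>\<^sub>0"
  have "0 < pi * \<alpha>"
    using assms by linarith
  then have \<alpha>: "0 < \<alpha>"
    by (simp add: zero_less_mult_iff)
  have S: "closed S"
    unfolding S_def by (intro closed_Un closed_vimage closed_nonneg_Reals_complex continuous_intros)
  have "lam * cis \<theta> \<notin> \<real>\<^sub>\<ge>\<^sub>0" if "\<bar>\<theta>\<bar> = pi * \<alpha>" for \<theta>
  proof
    assume "lam * cis \<theta> \<in> \<real>\<^sub>\<ge>\<^sub>0"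
    then obtain r where r: "lam * cis \<theta> = of_real r" "r \<ge> 0"
      by (auto elim: nonneg_Reals_cases)
    then have lam: "lam = of_real r * cis (- \<theta>)"
      by (metis cis_mult cis_zero mult.assoc mult.right_neutral add.right_inverse)
    then have "r > 0"
      using r assms by (cases "r = 0") auto
    have "pi * \<alpha> < pi"
      using assms by simp
    then have "- pi < - \<theta>" "- \<theta> \<le> pi"
      using that by linarith+
    then have "Arg lam = - \<theta>"
      using \<open>r > 0\<close> lam by (intro Arg_unique[of r]) (auto simp: cis_conv_exp)
    then show False
      using assms that by simp
  qed
  from this[of "pi * \<alpha>"] this[of "- (pi * \<alpha>)"] have "lam \<notin> S"
    using \<alpha> by (auto simp: S_def)
  then obtain m where m: "m > 0" "\<And>u. u \<in> S \<Longrightarrow> m \<le> dist lam u"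
    using separate_point_closed[OF S] by blast
  show thesis
  proof (rule that[OF m(1)])
    fix w :: complex and s :: real
    assume w: "\<bar>Im w\<bar> = pi" and s: "s > 0"
    have "Im w = pi \<or> Im w = - pi"
      using w by linarith
    moreover have "exp (of_real \<alpha> * w) / of_real s * cis (- (\<alpha> * Im w)) = of_real (exp (\<alpha> * Re w) / s)"
    proof -
      have "exp (of_real \<alpha> * w) = of_real (exp (\<alpha> * Re w)) * cis (\<alpha> * Im w)"
        by (simp add: complex_eq_iff Re_exp Im_exp)
      then show ?thesis
        by (simp add: cis_mult)
    qed
    moreover have "complex_of_real (exp (\<alpha> * Re w) / s) \<in> \<real>\<^sub>\<ge>\<^sub>0"
      unfolding nonneg_Reals_of_real_iff using s by simp
    ultimately have "exp (of_real \<alpha> * w) / of_real s \<in> S"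
      unfolding S_def vimage_def by (auto simp: mult.commute[of pi])
    from m(2)[OF this] have "m * s \<le> norm (exp (of_real \<alpha> * w) / of_real s - lam) * s"
      using s by (simp add: dist_norm norm_minus_commute)
    also have "\<dots> = norm ((exp (of_real \<alpha> * w) / of_real s - lam) * of_real s)"
      using s by (simp add: norm_mult)
    also have "(exp (of_real \<alpha> * w) / of_real s - lam) * of_real s = exp (of_real \<alpha> * w) - lam * of_real s"
      using s by (simp add: field_simps)
    finally show "m * s \<le> norm (exp (of_real \<alpha> * w) - lam * of_real s)" .
  qed
qed

text \<open>With z = lam s and s = t^\<alpha>, both |z| and the distance from z to the rays scale
  with s. The remainder is therefore a constant times t^(\<beta> - 1) / s^(M + 1), that is t^(-(c +
  M \<alpha>)), uniformly in t > 0.\<close>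

lemma mittag_leffler_expansion:
  assumes \<alpha>: "0 < \<alpha>" "\<alpha> < 1" and \<beta>: "\<beta> < 1 + \<alpha>" and lam: "lam \<noteq> 0" "\<bar>Arg lam\<bar> < pi * \<alpha>"
  defines "c \<equiv> 1 + \<alpha> - \<beta>"
  obtains C where "\<And>t. t > 0 \<Longrightarrow>
    norm (of_real (t powr (\<beta> - 1)) * mittag_leffler \<alpha> \<beta> (lam * of_real (t powr \<alpha>))
       - lam powr of_real ((1 - \<beta>) / \<alpha>) / of_real \<alpha> * exp (lam powr of_real (1 / \<alpha>) * of_real t)
       + (\<Sum>k<M. of_real (Gamma (c + k * \<alpha>) * sin ((c + k * \<alpha>) * pi) / pi) / lam ^ Suc k * of_real (t powr - (c + k * \<alpha>))))
     \<le> C / t powr (c + M * \<alpha>)"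
proof -
  obtain m where "m > 0" and
    m: "\<And>w s. \<bar>Im w\<bar> = pi \<Longrightarrow> s > 0 \<Longrightarrow> m * s \<le> norm (exp (of_real \<alpha> * w) - lam * of_real s)"
    using ray_separation[OF \<alpha>(2) lam] by blast
  \<comment> \<open>This is the remainder bound for the line integrals at
    \<open>norm z = norm lam * s\<close> and separation \<open>m * s\<close>, divided by 2 pi and
    freed of the factor \<open>1 / s ^ Suc M\<close>.\<close>
  define C where "C = Gamma (c + M * \<alpha>) / (pi * norm lam ^ M * m)"
  show thesis
  proof (rule that[of C])
    fix t :: real assume t: "t > 0"
    define s where "s = t powr \<alpha>"
    have s: "s > 0" and ln_s: "ln s = \<alpha> * ln t"
      using t by (simp_all add: s_def ln_powr)
    define z where "z = lam * of_real s"
    \<comment> \<open>A positive factor leaves the argument unchanged, so no branch correction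
      arises and the residue is expressed by principal powers of \<open>lam\<close>.\<close>
    have Ln_z: "Ln z = Ln lam + of_real (\<alpha> * ln t)"
      using Ln_times_of_real[OF s lam(1)] s by (simp add: z_def ln_s[symmetric] Ln_of_real mult.commute)
    have z: "z \<noteq> 0" "\<bar>Arg z\<bar> < pi * \<alpha>"
      using lam s by (auto simp: z_def Arg_times_of_real2)
    have ms: "m * s > 0"
      using \<open>m > 0\<close> s by simp
    have m_z: "m * s \<le> norm (exp (of_real \<alpha> * w) - z)" if "\<bar>Im w\<bar> = pi" for w
      using m[OF that s] by (simp add: z_def)
    define I where "I = (LINT x|lborel. branch_jump (ml_kernel \<alpha> \<beta> z) x)"
    define F where "F = lam powr of_real ((1 - \<beta>) / \<alpha>) / of_real \<alpha> * exp (lam powr of_real (1 / \<alpha>) * of_real t)"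
    define p where "p = Ln z / of_real \<alpha>"
    have p: "p = Ln lam / of_real \<alpha> + of_real (ln t)"
      using \<alpha> by (simp add: p_def Ln_z add_divide_distrib)
    have exp_p: "exp p = lam powr of_real (1 / \<alpha>) * of_real t"
      using t lam by (simp add: p exp_add powr_def exp_of_real)
    have "of_real (1 - \<beta>) * p = of_real ((1 - \<beta>) / \<alpha>) * Ln lam + of_real ((1 - \<beta>) * ln t)"
      by (simp add: p algebra_simps)
    then have "exp (of_real (1 - \<beta>) * p) = exp (of_real ((1 - \<beta>) / \<alpha>) * Ln lam) * of_real (exp ((1 - \<beta>) * ln t))"
      by (simp only: exp_add exp_of_real)
    then have exp_p': "exp (of_real (1 - \<beta>) * p) = lam powr of_real ((1 - \<beta>) / \<alpha>) * of_real (t powr (1 - \<beta>))"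
      using t lam by (simp only: powr_def) simp
    have "mittag_leffler \<alpha> \<beta> z = exp (exp p + of_real (1 - \<beta>) * p) / of_real \<alpha> + I / (2 * pi * \<i>)"
      unfolding I_def p_def
      by (rule mittag_leffler_eq_exp_plus_LINT[OF \<alpha> \<beta> z integrable_branch_jump_ml_kernel[OF \<alpha>(1) \<beta> z(1) ms m_z]])
    also have "exp (exp p + of_real (1 - \<beta>) * p) / of_real \<alpha> = of_real (t powr (1 - \<beta>)) * F"
      unfolding exp_add exp_p exp_p' F_def by simp
    finally have ml: "mittag_leffler \<alpha> \<beta> z = of_real (t powr (1 - \<beta>)) * F + I / (2 * pi * \<i>)" .
    have powr_cancel: "t powr (\<beta> - 1) * t powr (1 - \<beta>) = 1"
      using t by (simp flip: powr_add)
    \<comment> \<open>The prefactor cancels the power of t in the residue, so subtracting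
      \<open>F\<close> leaves exactly the line integrals.\<close>
    have G: "of_real (t powr (\<beta> - 1)) * mittag_leffler \<alpha> \<beta> z - F = of_real (t powr (\<beta> - 1)) * I / (2 * pi * \<i>)"
      unfolding ml distrib_left mult.assoc[symmetric] of_real_mult[symmetric] powr_cancel by simp
    have s_pow: "s ^ n = t powr (n * \<alpha>)" for n
      using t by (simp add: s_def powr_power mult.commute)
    have t_pow: "t powr (\<beta> - 1) / s ^ Suc k = t powr - (c + k * \<alpha>)" for k
      using t unfolding s_pow by (simp add: c_def powr_diff[symmetric] algebra_simps)
    define T where "T k = of_real (Gamma (c + k * \<alpha>)) * (2 * \<i> * of_real (sin ((c + k * \<alpha>) * pi))) / z ^ Suc k" for k :: nat
    have T: "of_real (t powr (\<beta> - 1)) * T k / (2 * pi * \<i>) =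
      of_real (Gamma (c + k * \<alpha>) * sin ((c + k * \<alpha>) * pi) / pi) / lam ^ Suc k * of_real (t powr - (c + k * \<alpha>))" for k
      unfolding t_pow[symmetric] T_def z_def power_mult_distrib by (simp add: field_simps)
    have "norm (I + (\<Sum>k<M. T k)) \<le> 2 * (1 / (norm z ^ M * (m * s))) * Gamma (c + M * \<alpha>)"
      unfolding I_def T_def c_def
      by (rule LINT_branch_jump_ml_kernel_expansion[OF \<alpha>(1) \<beta> z(1) ms m_z])
    also have "\<dots> = 2 * pi * C / s ^ Suc M"
      using s by (simp add: C_def z_def norm_mult power_mult_distrib)
    finally have I: "norm (I + (\<Sum>k<M. T k)) \<le> 2 * pi * C / s ^ Suc M" .
    have "norm (of_real (t powr (\<beta> - 1)) * mittag_leffler \<alpha> \<beta> z - F + (\<Sum>k<M. of_real (t powr (\<beta> - 1)) * T k / (2 * pi * \<i>)))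
        = norm (of_real (t powr (\<beta> - 1)) * (I + (\<Sum>k<M. T k)) / (2 * pi * \<i>))"
      unfolding G by (simp add: distrib_left add_divide_distrib sum_distrib_left sum_divide_distrib)
    also have "\<dots> = t powr (\<beta> - 1) * norm (I + (\<Sum>k<M. T k)) / (2 * pi)"
      by (simp add: norm_mult norm_divide)
    also have "\<dots> \<le> t powr (\<beta> - 1) * (2 * pi * C / s ^ Suc M) / (2 * pi)"
      by (intro divide_right_mono mult_left_mono I) auto
    also have "\<dots> = C * (t powr (\<beta> - 1) / s ^ Suc M)"
      by simp
    also have "\<dots> = C / t powr (c + M * \<alpha>)"
      unfolding t_pow powr_minus_divide by simp
    finally show "norm (of_real (t powr (\<beta> - 1)) * mittag_leffler \<alpha> \<beta> (lam * of_real (t powr \<alpha>))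
       - lam powr of_real ((1 - \<beta>) / \<alpha>) / of_real \<alpha> * exp (lam powr of_real (1 / \<alpha>) * of_real t)
       + (\<Sum>k<M. of_real (Gamma (c + k * \<alpha>) * sin ((c + k * \<alpha>) * pi) / pi) / lam ^ Suc k * of_real (t powr - (c + k * \<alpha>))))
     \<le> C / t powr (c + M * \<alpha>)"
      unfolding T F_def z_def s_def .
  qed
qed

section \<open>From remainder bounds to the stated expansions and coefficients\<close>

lemma has_poincare_expansionI:
  assumes "0 < \<mu> 1" "strict_mono_on {1..} \<mu>"
    and bound: "\<And>N. N \<ge> 1 \<Longrightarrow> \<exists>C. \<forall>t>0. norm (g t - (\<Sum>k=1..N. c k * of_real (t powr (- \<mu> k)))) \<le> C / t powr \<mu> (Suc N)"
  shows "has_poincare_expansion g c \<mu>"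
  unfolding has_poincare_expansion_def
proof (intro conjI allI impI)
  fix N :: nat assume N: "N \<ge> 1"
  let ?h = "\<lambda>t. g t - (\<Sum>k=1..N. c k * of_real (t powr (- \<mu> k)))"
  obtain C where C: "\<And>t. t > 0 \<Longrightarrow> norm (?h t) \<le> C / t powr \<mu> (Suc N)"
    using bound[OF N] by blast
  \<comment> \<open>The error has the order of the next term, whose exponent is strictly larger, so
    it is little-o of the last term kept.\<close>
  have "\<mu> N < \<mu> (Suc N)"
    using N by (intro strict_mono_onD[OF assms(2)]) auto
  then have "(\<lambda>t. t powr (- \<mu> (Suc N))) \<in> o[at_top](\<lambda>t. t powr (- \<mu> N))"
    by (subst powr_smallo_iff) (auto simp: filterlim_ident)
  moreover have "?h \<in> O[at_top](\<lambda>t. of_real (t powr (- \<mu> (Suc N))))"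
  proof (rule bigoI)
    show "\<forall>\<^sub>F t in at_top. norm (?h t) \<le> C * norm (complex_of_real (t powr (- \<mu> (Suc N))))"
      using eventually_gt_at_top[of 0]
    proof eventually_elim
      case (elim t)
      have "C * norm (complex_of_real (t powr (- \<mu> (Suc N)))) = C / t powr \<mu> (Suc N)"
        by (simp add: powr_minus_divide norm_divide)
      then show ?case
        using C[OF elim] by (simp only:)
    qed
  qed
  ultimately show "?h \<in> o[at_top](\<lambda>t. of_real (t powr (- \<mu> N)))"
    by (intro landau_o.big_small_trans[of ?h _ "\<lambda>t. of_real (t powr (- \<mu> (Suc N)))"]) (auto simp: smallo_def)
qed (use assms in auto)

text \<open>With x = pi \<alpha>, the addition theorem gives sin ((k+1) x) - sin x exp (i k x) = sin
  (k x) exp (- i x), and the last factor cancels the prefactor exp (i x).\<close>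

lemma coeff_a_eq:
  assumes "0 < \<alpha>" "\<alpha> < 1"
  shows "coeff_a \<alpha> lam k = - of_real (sin (real k * pi * \<alpha>) / pi) / lam ^ k"
proof -
  define x where "x = pi * \<alpha>"
  have "sin x > 0"
    using assms by (intro sin_gt_zero) (auto simp: x_def)
  have "of_real (sin x) * (of_real (sin (real (k + 1) * x) / sin x) - cis (real k * x))
      = complex_of_real (sin (real k * x + x)) - of_real (sin x) * cis (real k * x)"
    using \<open>sin x > 0\<close> by (simp add: algebra_simps)
  also have "\<dots> = of_real (sin (real k * x)) * cis (- x)"
    by (simp add: complex_eq_iff sin_add)
  finally have "cis x * (of_real (sin x) * (of_real (sin (real (k + 1) * x) / sin x) - cis (real k * x)))
      = of_real (sin (real k * x))"
    by (simp add: cis_mult mult_ac)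
  moreover have "coeff_a \<alpha> lam k = - (cis x * (of_real (sin x) * (of_real (sin (real (k + 1) * x) / sin x) - cis (real k * x)))) / (pi * lam ^ k)"
    unfolding coeff_a_def x_def by (simp add: cis_conv_exp mult_ac)
  ultimately show ?thesis
    by (simp add: x_def mult_ac)
qed

theorem theorem4p2:
  fixes \<alpha> :: real and lam :: complex
  assumes "0 < \<alpha>" and "\<alpha> < 1"
    and "lam \<noteq> 0" and "- (pi * \<alpha>) < Arg lam" and "Arg lam < pi * \<alpha>"
  shows "has_poincare_expansion
           (\<lambda>t. mittag_leffler \<alpha> 1 (lam * of_real (t powr \<alpha>))
                 - of_real (1 / \<alpha>) * exp (lam powr of_real (1 / \<alpha>) * of_real t))
           (\<lambda>k. coeff_a \<alpha> lam k * of_real (Gamma (real k * \<alpha>)))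
           (\<lambda>k. real k * \<alpha>)
       \<and> has_poincare_expansion
           (\<lambda>t. of_real (t powr (\<alpha> - 1)) * mittag_leffler \<alpha> \<alpha> (lam * of_real (t powr \<alpha>))
                 - lam powr of_real ((1 - \<alpha>) / \<alpha>) / of_real \<alpha> * exp (lam powr of_real (1 / \<alpha>) * of_real t))
           (\<lambda>k. coeff_b \<alpha> lam k * of_real (Gamma (real k * \<alpha> + 1)))
           (\<lambda>k. real k * \<alpha> + 1)
       \<and> (\<exists>t0>0. \<exists>K L :: real.
            (\<forall>t>0.
               cmod (mittag_leffler \<alpha> 1 (lam * of_real (t powr \<alpha>))
                     - of_real (1 / \<alpha>) * exp (lam powr of_real (1 / \<alpha>) * of_real t))
                 \<le> K / t powr \<alpha>) \<and>
            (\<forall>t\<ge>t0.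
               cmod (of_real (t powr (\<alpha> - 1)) * mittag_leffler \<alpha> \<alpha> (lam * of_real (t powr \<alpha>))
                     - lam powr of_real ((1 - \<alpha>) / \<alpha>) / of_real \<alpha> * exp (lam powr of_real (1 / \<alpha>) * of_real t))
                 \<le> L / t powr (\<alpha> + 1)))"
  (is "has_poincare_expansion ?g ?a ?\<mu> \<and> has_poincare_expansion ?h ?b ?\<nu> \<and> _")
proof -
  have Arg: "\<bar>Arg lam\<bar> < pi * \<alpha>"
    using assms by linarith
  have g: "\<exists>C. \<forall>t>0. norm (?g t - (\<Sum>k=1..N. ?a k * of_real (t powr - ?\<mu> k))) \<le> C / t powr ?\<mu> (Suc N)" for N
  proof -
    \<comment> \<open>At \<beta> = 1 the first exponent is \<alpha>, so the term of index k in the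
      sum below N is the term k + 1 of the expansion.\<close>
    obtain C where C: "\<And>t. t > 0 \<Longrightarrow>
      norm (of_real (t powr (1 - 1)) * mittag_leffler \<alpha> 1 (lam * of_real (t powr \<alpha>))
         - lam powr of_real ((1 - 1) / \<alpha>) / of_real \<alpha> * exp (lam powr of_real (1 / \<alpha>) * of_real t)
         + (\<Sum>k<N. of_real (Gamma (1 + \<alpha> - 1 + k * \<alpha>) * sin ((1 + \<alpha> - 1 + k * \<alpha>) * pi) / pi) / lam ^ Suc k
             * of_real (t powr - (1 + \<alpha> - 1 + k * \<alpha>))))
       \<le> C / t powr (1 + \<alpha> - 1 + N * \<alpha>)"
      using mittag_leffler_expansion[of \<alpha> 1 lam N] assms Arg by auto
    have \<mu>: "1 + \<alpha> - 1 + real k * \<alpha> = ?\<mu> (Suc k)" for k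
      by (simp add: algebra_simps)
    have coeff: "of_real (Gamma (?\<mu> k) * sin (?\<mu> k * pi) / pi) / lam ^ k = - ?a k" for k
      using assms by (simp add: coeff_a_eq mult_ac)
    have "norm (?g t - (\<Sum>k=1..N. ?a k * of_real (t powr - ?\<mu> k))) \<le> C / t powr ?\<mu> (Suc N)" if "t > 0" for t
      using C[OF that] that assms unfolding \<mu> coeff
      by (simp add: sum.atLeast1_atMost_eq sum_negf)
    then show ?thesis by blast
  qed
  have h: "\<exists>C. \<forall>t>0. norm (?h t - (\<Sum>k=1..N. ?b k * of_real (t powr - ?\<nu> k))) \<le> C / t powr ?\<nu> (Suc N)" for N
  proof -
    \<comment> \<open>At \<beta> = \<alpha> the first exponent is 1, but its coefficient contains
      sin pi = 0. The expansion thus starts at index 1 with exponent \<alpha> + 1, and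
      \<open>Suc N\<close> terms are taken to retain N of them.\<close>
    obtain C where C: "\<And>t. t > 0 \<Longrightarrow>
      norm (?h t
         + (\<Sum>k<Suc N. of_real (Gamma (1 + \<alpha> - \<alpha> + k * \<alpha>) * sin ((1 + \<alpha> - \<alpha> + k * \<alpha>) * pi) / pi) / lam ^ Suc k
             * of_real (t powr - (1 + \<alpha> - \<alpha> + k * \<alpha>))))
       \<le> C / t powr (1 + \<alpha> - \<alpha> + Suc N * \<alpha>)"
      using mittag_leffler_expansion[of \<alpha> \<alpha> lam "Suc N"] assms Arg by auto
    have \<nu>: "1 + \<alpha> - \<alpha> + real k * \<alpha> = ?\<nu> k" for k
      by simp
    have coeff: "of_real (Gamma (?\<nu> k) * sin (?\<nu> k * pi) / pi) / lam ^ Suc k = - ?b k" for k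
    proof -
      have "?\<nu> k * pi = real k * pi * \<alpha> + pi"
        by (simp add: algebra_simps)
      then have sin: "sin (?\<nu> k * pi) = - sin (real k * pi * \<alpha>)"
        by (simp only: sin_periodic_pi)
      show ?thesis
        unfolding sin using assms by (simp add: coeff_b_def coeff_a_eq mult_ac)
    qed
    have b0: "?b 0 = 0"
      using assms by (simp add: coeff_b_def coeff_a_eq)
    have "norm (?h t - (\<Sum>k=1..N. ?b k * of_real (t powr - ?\<nu> k))) \<le> C / t powr ?\<nu> (Suc N)" if "t > 0" for t
      using C[OF that] unfolding \<nu> coeff sum.lessThan_Suc_shift b0
      by (simp add: sum.atLeast1_atMost_eq sum_negf)
    then show ?thesis by blast
  qed
  have "has_poincare_expansion ?g ?a ?\<mu>"
    using assms by (intro has_poincare_expansionI g) (auto simp: strict_mono_on_def)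
  moreover have "has_poincare_expansion ?h ?b ?\<nu>"
    using assms by (intro has_poincare_expansionI h) (auto simp: strict_mono_on_def)
  \<comment> \<open>For N = 0 the sum is empty, so the remainder bound is the global estimate with
    the first exponent. The same holds for \<open>?h\<close>, and \<open>t0 = 1\<close> is one
    admissible choice.\<close>
  moreover obtain K where "\<forall>t>0. norm (?g t) \<le> K / t powr \<alpha>"
    using g[of 0] by auto
  moreover obtain L where "\<forall>t>0. norm (?h t) \<le> L / t powr (\<alpha> + 1)"
    using h[of 0] by auto
  then have "\<forall>t\<ge>1. norm (?h t) \<le> L / t powr (\<alpha> + 1)"
    by auto
  ultimately show ?thesis
    by (intro conjI exI[of _ 1] exI[of _ K] exI[of _ L]) auto
qed

end
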